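(* Let $N$ be a 2-step nilpotent Lie group of dimension $2n$ with $n\leq 3$. Then $N$ admits a left-invariant symplectic structure if and only if it admits a closed left-invariant 2-form of type II, with the exception of the trivial extension of the Heisenberg Lie group of dimension five (i.e. the group with Lie algebra $\mathfrak{h}_2(\mathbb{R})\oplus\mathbb{R}$), for which this equivalence does not hold.
   Context: All Lie groups and Lie algebras are real and finite-dimensional. A Lie group is 2-step nilpotent if its Lie algebra $\mathfrak{n}$ is non-abelian and satisfies $[[U,V],W]=0$ for all $U,V,W$. Left-invariant 2-forms are identified with 2-forms on $\mathfrak{n}$. A 2-form $\omega$ on $\mathfrak{n}$ is closed if $\omega([U,V],W)+\omega([V,W],U)+\omega([W,U],V)=0$ for all $U,V,W\in\mathfrak{n}$; it is symplectic if it is closed and non-degenerate. With $\mathfrak{z}$ the center of $\mathfrak{n}$, a 2-form $\omega$ is of type II if $\omega(Z,Z')=0$ for all $Z,Z'\in\mathfrak{z}$, but $\omega(Z,U)\neq0$ for some $Z\in\mathfrak{z}$, $U\in\mathfrak{n}$. $\mathfrak{h}_2(\mathbb{R})$ is the 5-dimensional Heisenberg Lie algebra with basis $e_1,\dots,e_5$ and non-trivial brackets $[e_1,e_2]=[e_3,e_4]=e_5$; $\mathfrak{h}_2(\mathbb{R})\oplus\mathbb{R}$ is its direct sum with a one-dimensional abelian Lie algebra. *)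

theory Defs
  imports "HOL-Analysis.Analysis" "HOL-Algebra.Group"
begin

subsection \<open>Lie algebras given by a bracket on a real vector space, and 2-forms\<close>

definition two_step_nilpotent :: "('e::real_vector \<Rightarrow> 'e \<Rightarrow> 'e) \<Rightarrow> bool" where
  "two_step_nilpotent b \<longleftrightarrow>
     (\<exists>U V. b U V \<noteq> 0) \<and> (\<forall>U V W. b (b U V) W = 0)"

definition lie_center :: "('e::real_vector \<Rightarrow> 'e \<Rightarrow> 'e) \<Rightarrow> 'e set" where
  "lie_center b = {Z. \<forall>U. b Z U = 0}"

definition lie_isomorphic ::
  "('e::real_vector \<Rightarrow> 'e \<Rightarrow> 'e) \<Rightarrow> ('f::real_vector \<Rightarrow> 'f \<Rightarrow> 'f) \<Rightarrow> bool" where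
  "lie_isomorphic b c \<longleftrightarrow>
     (\<exists>f. linear f \<and> bij f \<and> (\<forall>U V. f (b U V) = c (f U) (f V)))"

definition two_form :: "('e::real_vector \<Rightarrow> 'e \<Rightarrow> real) \<Rightarrow> bool" where
  "two_form \<omega> \<longleftrightarrow> bilinear \<omega> \<and> (\<forall>U. \<omega> U U = 0)"

definition closed_form ::
  "('e::real_vector \<Rightarrow> 'e \<Rightarrow> 'e) \<Rightarrow> ('e \<Rightarrow> 'e \<Rightarrow> real) \<Rightarrow> bool" where
  "closed_form b \<omega> \<longleftrightarrow>
     (\<forall>U V W. \<omega> (b U V) W + \<omega> (b V W) U + \<omega> (b W U) V = 0)"

definition nondegenerate :: "('e::real_vector \<Rightarrow> 'e \<Rightarrow> real) \<Rightarrow> bool" where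
  "nondegenerate \<omega> \<longleftrightarrow> (\<forall>U. (\<forall>V. \<omega> U V = 0) \<longrightarrow> U = 0)"

definition symplectic_form ::
  "('e::real_vector \<Rightarrow> 'e \<Rightarrow> 'e) \<Rightarrow> ('e \<Rightarrow> 'e \<Rightarrow> real) \<Rightarrow> bool" where
  "symplectic_form b \<omega> \<longleftrightarrow> two_form \<omega> \<and> closed_form b \<omega> \<and> nondegenerate \<omega>"

definition type_II ::
  "('e::real_vector \<Rightarrow> 'e \<Rightarrow> 'e) \<Rightarrow> ('e \<Rightarrow> 'e \<Rightarrow> real) \<Rightarrow> bool" where
  "type_II b \<omega> \<longleftrightarrow>
     (\<forall>Z\<in>lie_center b. \<forall>Z'\<in>lie_center b. \<omega> Z Z' = 0) \<and>
     (\<exists>Z\<in>lie_center b. \<exists>U. \<omega> Z U \<noteq> 0)"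

text \<open>The index type \<open>5\<close> consists of the residues modulo 5, so the indices 1, 2, 3, 4, 5 are its
  five distinct elements (and the index 5 coincides with 0).\<close>

definition h2_bracket :: "real^5 \<Rightarrow> real^5 \<Rightarrow> real^5" where
  "h2_bracket u v =
     ((u $ 1 * v $ 2 - u $ 2 * v $ 1) + (u $ 3 * v $ 4 - u $ 4 * v $ 3)) *\<^sub>R axis 5 1"

definition direct_sum_bracket ::
  "('e \<Rightarrow> 'e \<Rightarrow> 'e) \<Rightarrow> ('f \<Rightarrow> 'f \<Rightarrow> 'f) \<Rightarrow> 'e \<times> 'f \<Rightarrow> 'e \<times> 'f \<Rightarrow> 'e \<times> 'f" where
  "direct_sum_bracket b c u v = (b (fst u) (fst v), c (snd u) (snd v))"

definition h2_plus_R_bracket :: "(real^5) \<times> real \<Rightarrow> (real^5) \<times> real \<Rightarrow> (real^5) \<times> real" where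
  "h2_plus_R_bracket = direct_sum_bracket h2_bracket (\<lambda>_ _. 0)"


subsection \<open>Smooth manifolds\<close>

text \<open>\<open>C_k_on k f S\<close>: all iterated directional derivatives of \<open>f\<close> of order less than \<open>k\<close> are
  Frechet differentiable on \<open>S\<close>, and those of order \<open>k\<close> are continuous. It is meant for open \<open>S\<close>.\<close>

primrec C_k_on ::
  "nat \<Rightarrow> ('a::real_normed_vector \<Rightarrow> 'b::real_normed_vector) \<Rightarrow> 'a set \<Rightarrow> bool" where
  "C_k_on 0 f S \<longleftrightarrow> continuous_on S f"
| "C_k_on (Suc k) f S \<longleftrightarrow>
     (\<forall>x\<in>S. f differentiable (at x)) \<and>
     (\<forall>v. C_k_on k (\<lambda>x. frechet_derivative f (at x) v) S)"

definition smooth_on ::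
  "'a::real_normed_vector set \<Rightarrow> ('a \<Rightarrow> 'b::real_normed_vector) \<Rightarrow> bool" where
  "smooth_on S f \<longleftrightarrow> open S \<and> (\<forall>k. C_k_on k f S)"

text \<open>A chart is a pair of its domain and its coordinate map; the values of the coordinate map
  outside the domain are irrelevant.\<close>

type_synonym ('p, 'e) chart = "'p set \<times> ('p \<Rightarrow> 'e)"

definition is_chart :: "'p topology \<Rightarrow> ('p, 'e::real_normed_vector) chart \<Rightarrow> bool" where
  "is_chart T c \<longleftrightarrow> (case c of (U, \<phi>) \<Rightarrow>
     openin T U \<and> open (\<phi> ` U) \<and>
     homeomorphic_map (subtopology T U) (top_of_set (\<phi> ` U)) \<phi>)"

definition smooth_map ::
  "'p topology \<Rightarrow> ('p, 'e::real_normed_vector) chart set \<Rightarrow>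
   'q topology \<Rightarrow> ('q, 'f::real_normed_vector) chart set \<Rightarrow> ('p \<Rightarrow> 'q) \<Rightarrow> bool" where
  "smooth_map T A T' A' f \<longleftrightarrow>
     continuous_map T T' f \<and>
     (\<forall>(U, \<phi>)\<in>A. \<forall>(V, \<psi>)\<in>A'.
        smooth_on (\<phi> ` {x\<in>U. f x \<in> V}) (\<psi> \<circ> f \<circ> inv_into U \<phi>))"

definition product_atlas ::
  "('p, 'e) chart set \<Rightarrow> ('q, 'f) chart set \<Rightarrow> ('p \<times> 'q, 'e \<times> 'f) chart set" where
  "product_atlas A B = {(U \<times> V, map_prod \<phi> \<psi>) |U \<phi> V \<psi>. (U, \<phi>) \<in> A \<and> (V, \<psi>) \<in> B}"

text \<open>The dimension of the manifold is \<open>DIM('e)\<close>. The atlas is not required to be maximal.\<close>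

locale smooth_manifold =
  fixes T :: "'p topology" and A :: "('p, 'e::euclidean_space) chart set"
  assumes Hausdorff: "Hausdorff_space T"
    and second_countable: "second_countable T"
    and charts: "c \<in> A \<Longrightarrow> is_chart T c"
    and cover: "topspace T = (\<Union>(U, \<phi>)\<in>A. U)"
    and transition: "(U, \<phi>) \<in> A \<Longrightarrow> (V, \<psi>) \<in> A \<Longrightarrow>
      smooth_on (\<phi> ` (U \<inter> V)) (\<psi> \<circ> inv_into U \<phi>)"


subsection \<open>Lie groups and their Lie algebras\<close>

locale lie_group = group G + smooth_manifold T A
  for G (structure) and T :: "'p topology" and A :: "('p, 'e::euclidean_space) chart set" +
  assumes topspace_eq: "topspace T = carrier G"
    and smooth_mult:
      "smooth_map (prod_topology T T) (product_atlas A A) T A (\<lambda>(x, y). x \<otimes> y)"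
    and smooth_inv: "smooth_map T A T A (m_inv G)"

text \<open>Let \<open>(U, \<phi>)\<close> be a chart around the identity. It identifies the tangent space at the
  identity with the model space \<open>'e\<close>. In this chart, the left-invariant vector field with value
  \<open>v\<close> at the identity takes at \<open>g\<close> the value \<open>d(L\<^sub>g) v\<close>, with \<open>L\<^sub>g\<close> the left translation by \<open>g\<close>.\<close>

definition left_invariant_field ::
  "('p, 'm) monoid_scheme \<Rightarrow> ('p, 'e::real_normed_vector) chart \<Rightarrow> 'e \<Rightarrow> 'e \<Rightarrow> 'e" where
  "left_invariant_field G c v = (case c of (U, \<phi>) \<Rightarrow>
     (\<lambda>x. frechet_derivative (\<lambda>y. \<phi> (inv_into U \<phi> x \<otimes>\<^bsub>G\<^esub> inv_into U \<phi> y))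
            (at (\<phi> \<one>\<^bsub>G\<^esub>)) v))"

text \<open>The sign is that of the commutator \<open>X Y - Y X\<close> of derivations.\<close>

definition vector_field_bracket ::
  "('e::real_normed_vector \<Rightarrow> 'e) \<Rightarrow> ('e \<Rightarrow> 'e) \<Rightarrow> 'e \<Rightarrow> 'e" where
  "vector_field_bracket X Y x =
     frechet_derivative Y (at x) (X x) - frechet_derivative X (at x) (Y x)"

text \<open>The Lie algebra of left-invariant vector fields, transported to the tangent space at the
  identity, which is identified with \<open>'e\<close> by the chart \<open>c\<close>. Another chart around the identity
  gives an isomorphic Lie algebra.\<close>

definition lie_bracket ::
  "('p, 'm) monoid_scheme \<Rightarrow> ('p, 'e::real_normed_vector) chart \<Rightarrow> 'e \<Rightarrow> 'e \<Rightarrow> 'e" where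
  "lie_bracket G c v w =
     vector_field_bracket (left_invariant_field G c v) (left_invariant_field G c w)
       (snd c \<one>\<^bsub>G\<^esub>)"

end

theory Submission
  imports Defs
begin

text \<open>
  In a chart around the identity, group multiplication is a smooth map \<open>F\<close> of two variables, and
  the left-invariant field of \<open>v\<close> takes at \<open>x\<close> the value \<open>dF\<close> at \<open>(x, e)\<close> applied to \<open>(0, v)\<close>. As
  \<open>F\<close> is twice differentiable, the bracket is bilinear; it is alternating by definition, and for a
  two-step nilpotent bracket every term of the Jacobi identity vanishes. What remains is linear
  algebra on a Lie algebra \<open>\<nn>\<close> with center \<open>\<zz>\<close> (locale \<open>two_step_lie_algebra\<close>).

  A symplectic form gives a closed form of type II in every dimension
  (\<open>closed_type_II_if_symplectic\<close>). For a closed form, \<open>[\<nn>,\<nn>]\<close> is orthogonal to \<open>\<zz>\<close>. Split off a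
  complement of \<open>[\<nn>,\<nn>]\<close> in \<open>\<zz>\<close>; the projection killing it is a Lie algebra endomorphism, and the
  form pulled back along it is isotropic on \<open>\<zz>\<close> while still pairing \<open>[\<nn>,\<nn>]\<close> nontrivially.

  For the converse, every two-step nilpotent Lie algebra of even dimension at most six is either
  symplectic or \<open>h\<^sub>2(\<real>) \<oplus> \<real>\<close> (\<open>symplectic_or_heisenberg\<close>). This is seen by producing in each case a
  basis in which the standard symplectic form is closed. If some \<open>[e\<^sub>1,\<cdot>]\<close> has rank at least two,
  then \<open>e\<^sub>1\<close>, two vectors \<open>e\<^sub>2, e\<^sub>3\<close> and their images \<open>f\<^sub>1, f\<^sub>2\<close> are independent, so the dimension
  is six and there is just one further basis vector \<open>g\<close>, which can be made to commute with \<open>e\<^sub>1\<close>.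
  Either a vector \<open>g + l e\<^sub>1\<close> is central (\<open>symplectic_if_central\<close>), or the derived algebra is
  spanned by \<open>f\<^sub>1, f\<^sub>2\<close> and \<open>e\<^sub>2, e\<^sub>3\<close> can be chosen such that \<open>[g,e\<^sub>2] = [e\<^sub>1,e\<^sub>3]\<close>
  (\<open>symplectic_if_noncentral\<close>). If all maps \<open>[x,\<cdot>]\<close> have rank at most one, the bracket is
  \<open>\<phi>(u,v) f\<close> for a 2-form \<open>\<phi>\<close> with \<open>f\<close> in its kernel
  (\<open>brackets_on_line_if_ad_rank_one\<close>). When \<open>\<phi>\<close> has rank two, a standard symplectic form is closed;
  when \<open>\<phi>\<close> has rank four, the algebra is \<open>h\<^sub>2(\<real>) \<oplus> \<real>\<close>.

  Finally, in \<open>h\<^sub>2(\<real>) \<oplus> \<real>\<close> the vector \<open>e\<^sub>5\<close> lies in the kernel of every closed form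
  (\<open>closed_form_kernel\<close>), so that there is no symplectic form, whereas \<open>e\<^sup>6 \<and> e\<^sup>1\<close>, with \<open>e\<^sub>6\<close>
  spanning the abelian summand, is closed and of type II.
\<close>

section \<open>The Lie bracket of a Lie group\<close>

text \<open>All three properties are read off from the coordinate expression \<open>F\<close> of the multiplication:
  near the identity, \<open>X v x\<close> is the derivative of \<open>F\<close> at \<open>(x, e)\<close> in the direction \<open>(0, v)\<close>.
  Linearity in \<open>v\<close> uses that \<open>F\<close> is differentiable, differentiability in \<open>x\<close> that \<open>F\<close> is so
  twice.\<close>

lemma left_invariant_field_regularity:
  fixes A :: "('p, 'e::euclidean_space) chart set"
  assumes "lie_group G T A" and "(U, \<phi>) \<in> A" and "\<one>\<^bsub>G\<^esub> \<in> U"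
  defines "X \<equiv> left_invariant_field G (U, \<phi>)"
  shows "open (\<phi> ` U)"
    and "x \<in> \<phi> ` U \<Longrightarrow> linear (\<lambda>v. X v x)"
    and "X v differentiable (at (\<phi> \<one>\<^bsub>G\<^esub>))"
proof -
  interpret lie_group G T A by fact
  have chart: "is_chart T (U, \<phi>)"
    using charts assms(2) .
  show op: "open (\<phi> ` U)"
    using chart by (simp add: is_chart_def)
  have U: "U \<subseteq> carrier G"
    using chart openin_subset[of T U] by (simp add: is_chart_def topspace_eq)
  have inj: "inj_on \<phi> U"
    using chart U
    by (auto simp: is_chart_def homeomorphic_map_def topspace_eq Int_absorb1
        dest!: homeomorphic_imp_injective_map)
  define e where "e = \<phi> \<one>\<^bsub>G\<^esub>"
  define S where "S = map_prod \<phi> \<phi> ` {p \<in> U \<times> U. (\<lambda>(x, y). x \<otimes>\<^bsub>G\<^esub> y) p \<in> U}"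
  define F where "F = \<phi> \<circ> (\<lambda>(x, y). x \<otimes>\<^bsub>G\<^esub> y) \<circ> inv_into (U \<times> U) (map_prod \<phi> \<phi>)"
  have "(U \<times> U, map_prod \<phi> \<phi>) \<in> product_atlas A A"
    using assms(2) by (auto simp: product_atlas_def)
  then have "smooth_on S F"
    using smooth_mult assms(2) unfolding smooth_map_def S_def F_def by blast
  then have S: "open S" and "C_k_on 2 F S"
    by (simp_all add: smooth_on_def del: C_k_on.simps)
  then have F: "\<And>p. p \<in> S \<Longrightarrow> F differentiable (at p)"
    and DF: "\<And>p w. p \<in> S \<Longrightarrow> (\<lambda>p. frechet_derivative F (at p) w) differentiable (at p)"
    by (auto simp: numeral_2_eq_2)
  have inj2: "inj_on (map_prod \<phi> \<phi>) (U \<times> U)"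
    using inj by (auto simp: inj_on_def)
  have F_eq: "F (x, y) = \<phi> (inv_into U \<phi> x \<otimes>\<^bsub>G\<^esub> inv_into U \<phi> y)" if xy: "(x, y) \<in> S" for x y
  proof -
    obtain g h where "g \<in> U" "h \<in> U" "x = \<phi> g" "y = \<phi> h"
      using xy by (auto simp: S_def)
    moreover from this have "inv_into (U \<times> U) (map_prod \<phi> \<phi>) (\<phi> g, \<phi> h) = (g, h)"
      using inv_into_f_f[OF inj2, of "(g, h)"] by simp
    ultimately show ?thesis
      by (simp add: F_def inj)
  qed
  have S_e: "(x, e) \<in> S" if x: "x \<in> \<phi> ` U" for x
  proof -
    obtain g where "g \<in> U" "x = \<phi> g" using x by blast
    moreover have "g \<otimes>\<^bsub>G\<^esub> \<one>\<^bsub>G\<^esub> = g" using \<open>g \<in> U\<close> U by auto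
    ultimately show ?thesis
      using assms(3) by (auto simp: S_def e_def intro!: image_eqI[of _ _ "(g, \<one>\<^bsub>G\<^esub>)"])
  qed
  have X_eq: "X v x = frechet_derivative F (at (x, e)) (0, v)" if x: "x \<in> \<phi> ` U" for v x
  proof -
    have "(F has_derivative frechet_derivative F (at (x, e))) (at (x, e))"
      using F[OF S_e[OF x]] frechet_derivative_works by blast
    moreover have "((\<lambda>y. (x, y)) has_derivative (\<lambda>v. (0, v))) (at e)"
      by (auto intro!: derivative_eq_intros)
    ultimately have "((\<lambda>y. F (x, y)) has_derivative (\<lambda>v. frechet_derivative F (at (x, e)) (0, v))) (at e)"
      using has_derivative_compose by fast
    moreover have "open ((\<lambda>y. (x, y)) -` S)"
      by (intro open_vimage S continuous_intros)
    ultimately have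
      "((\<lambda>y. \<phi> (inv_into U \<phi> x \<otimes>\<^bsub>G\<^esub> inv_into U \<phi> y)) has_derivative
         (\<lambda>v. frechet_derivative F (at (x, e)) (0, v))) (at e)"
      by (rule has_derivative_transform_within_open) (use S_e[OF x] F_eq in auto)
    from frechet_derivative_at[OF this] show ?thesis
      unfolding X_def left_invariant_field_def by (simp add: e_def fun_eq_iff)
  qed
  show "linear (\<lambda>v. X v x)" if x: "x \<in> \<phi> ` U"
  proof -
    have lin: "linear (frechet_derivative F (at (x, e)))"
      using F[OF S_e[OF x]] linear_frechet_derivative by blast
    have "linear (\<lambda>v::'e. (0::'e, v))"
      by (rule linearI) auto
    from linear_compose[OF this lin] show ?thesis
      unfolding X_eq[OF x] by (simp add: o_def)
  qed
  have e: "e \<in> \<phi> ` U"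
    using assms(3) by (simp add: e_def)
  have "(\<lambda>x. frechet_derivative F (at (x, e)) (0, v)) differentiable (at e)"
  proof -
    have "(\<lambda>x. (x, e)) differentiable (at e)"
      by simp
    then show ?thesis
      using differentiable_chain_at[of "\<lambda>x. (x, e)" e "\<lambda>p. frechet_derivative F (at p) (0, v)"]
        DF[OF S_e[OF e]] by (simp add: o_def)
  qed
  then obtain D where "((\<lambda>x. frechet_derivative F (at (x, e)) (0, v)) has_derivative D) (at e)"
    by (auto simp: differentiable_def)
  then have "(X v has_derivative D) (at e)"
    by (rule has_derivative_transform_within_open[OF _ op e]) (simp add: X_eq)
  then show "X v differentiable (at (\<phi> \<one>\<^bsub>G\<^esub>))"
    by (auto simp: differentiable_def e_def)
qed

text \<open>The field \<open>X v\<close> depends linearly on \<open>v\<close> on a whole neighbourhood of the identity, so its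
  derivative there does as well.\<close>

lemma lie_bracket_bilinear:
  fixes A :: "('p, 'e::euclidean_space) chart set"
  assumes "lie_group G T A" and "(U, \<phi>) \<in> A" and "\<one>\<^bsub>G\<^esub> \<in> U"
  shows "bilinear (lie_bracket G (U, \<phi>))"
proof -
  define X where "X = left_invariant_field G (U, \<phi>)"
  define e where "e = \<phi> \<one>\<^bsub>G\<^esub>"
  note reg = left_invariant_field_regularity[OF assms, folded X_def e_def]
  have e: "e \<in> \<phi> ` U" using assms(3) by (simp add: e_def)
  have deriv: "(X v has_derivative frechet_derivative (X v) (at e)) (at e)" for v
    using reg(3) frechet_derivative_works by blast
  have lin1: "linear (frechet_derivative (X v) (at e))" for v
    using reg(3) linear_frechet_derivative by blast
  have lin2: "linear (\<lambda>v. X v e)"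
    using reg(2) e .
  have lin3: "linear (\<lambda>v. frechet_derivative (X v) (at e) u)" for u
  proof (rule linearI)
    fix v w
    have "((\<lambda>x. X v x + X w x) has_derivative
        (\<lambda>u. frechet_derivative (X v) (at e) u + frechet_derivative (X w) (at e) u)) (at e)"
      by (intro has_derivative_add deriv)
    then have "(X (v + w) has_derivative
        (\<lambda>u. frechet_derivative (X v) (at e) u + frechet_derivative (X w) (at e) u)) (at e)"
      by (rule has_derivative_transform_within_open[OF _ reg(1) e])
        (use linear_add[OF reg(2)] in metis)
    from frechet_derivative_at[OF this]
    show "frechet_derivative (X (v + w)) (at e) u
        = frechet_derivative (X v) (at e) u + frechet_derivative (X w) (at e) u"
      by metis
  next
    fix r v
    have "((\<lambda>x. r *\<^sub>R X v x) has_derivative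
        (\<lambda>u. r *\<^sub>R frechet_derivative (X v) (at e) u)) (at e)"
      by (intro has_derivative_scaleR_right deriv)
    then have "(X (r *\<^sub>R v) has_derivative
        (\<lambda>u. r *\<^sub>R frechet_derivative (X v) (at e) u)) (at e)"
      by (rule has_derivative_transform_within_open[OF _ reg(1) e])
        (use linear_scale[OF reg(2)] in metis)
    from frechet_derivative_at[OF this]
    show "frechet_derivative (X (r *\<^sub>R v)) (at e) u = r *\<^sub>R frechet_derivative (X v) (at e) u"
      by metis
  qed
  have eq: "lie_bracket G (U, \<phi>) =
      (\<lambda>v w. frechet_derivative (X w) (at e) (X v e) - frechet_derivative (X v) (at e) (X w e))"
    by (simp add: fun_eq_iff lie_bracket_def vector_field_bracket_def X_def e_def)
  have "linear (\<lambda>v. frechet_derivative (X w) (at e) (X v e))" for w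
    using linear_compose[OF lin2 lin1, of w] by (simp add: o_def)
  then show ?thesis
    unfolding eq bilinear_def
    by (intro conjI allI linear_compose_sub) (auto intro: lin3)
qed

lemma lie_bracket_self: "lie_bracket G c v v = 0"
  by (simp add: lie_bracket_def vector_field_bracket_def)

section \<open>Coordinates with respect to a finite list of vectors\<close>

text \<open>Linear independence of a list rather than of a set: a repeated vector makes the list dependent,
  and the entries of an explicit list can be tested by comparing coefficients.\<close>

definition lin_indep :: "'e::euclidean_space list \<Rightarrow> bool" where
  "lin_indep vs \<longleftrightarrow>
     (\<forall>a. (\<Sum>i<length vs. a i *\<^sub>R vs ! i) = 0 \<longrightarrow> (\<forall>i<length vs. a i = 0))"

lemma lin_indep_iff: "lin_indep vs \<longleftrightarrow> distinct vs \<and> independent (set vs)"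
proof
  assume L: "lin_indep vs"
  have d: "distinct vs"
  proof (rule ccontr)
    assume "\<not> distinct vs"
    then obtain i j where ij: "i < length vs" "j < length vs" "i \<noteq> j" "vs ! i = vs ! j"
      by (auto simp: distinct_conv_nth)
    have "(\<Sum>k<length vs. (if k = i then 1 else if k = j then -1 else 0) *\<^sub>R vs ! k)
        = (\<Sum>k<length vs. (if k = i then vs ! k else 0) - (if k = j then vs ! k else 0))"
      by (rule sum.cong) (use ij in auto)
    also have "\<dots> = 0"
      using ij by (simp add: sum_subtractf sum.delta)
    finally show False
      using L[unfolded lin_indep_def, rule_format,
          of "\<lambda>k. if k = i then 1 else if k = j then -1 else 0" i] ij by simp
  qed
  have bij: "bij_betw ((!) vs) {..<length vs} (set vs)"
    using d by (rule bij_betw_nth) auto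
  have "independent (set vs)"
  proof (rule independent_if_scalars_zero)
    fix f x assume "(\<Sum>x\<in>set vs. f x *\<^sub>R x) = 0" "x \<in> set vs"
    then show "f x = 0"
      using L[unfolded lin_indep_def, rule_format, of "\<lambda>i. f (vs ! i)"]
      by (auto simp: sum.reindex_bij_betw[OF bij, symmetric] in_set_conv_nth)
  qed simp
  with d show "distinct vs \<and> independent (set vs)" by simp
next
  assume R: "distinct vs \<and> independent (set vs)"
  then have bij: "bij_betw ((!) vs) {..<length vs} (set vs)"
    by (intro bij_betw_nth) auto
  show "lin_indep vs"
    unfolding lin_indep_def
  proof (intro allI impI)
    fix a :: "nat \<Rightarrow> real" and i
    assume a: "(\<Sum>i<length vs. a i *\<^sub>R vs ! i) = 0" and i: "i < length vs"
    define f where "f x = a (inv_into {..<length vs} ((!) vs) x)" for x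
    have f: "f (vs ! j) = a j" if "j < length vs" for j
      using inv_into_f_f[OF bij_betw_imp_inj_on[OF bij], of j] that by (simp add: f_def)
    have "(\<Sum>x\<in>set vs. f x *\<^sub>R x) = 0"
      using a f by (simp add: sum.reindex_bij_betw[OF bij, symmetric])
    then have "f (vs ! i) = 0"
      using independentD[of "set vs" "set vs" f "vs ! i"] R i by auto
    then show "a i = 0" using f i by simp
  qed
qed

lemma lin_indep_length_le:
  fixes vs :: "'e::euclidean_space list"
  assumes "lin_indep vs" shows "length vs \<le> DIM('e)"
  using assms independent_bound[of "set vs"] by (simp add: lin_indep_iff distinct_card)

lemma lin_indep_extend:
  fixes vs :: "'e::euclidean_space list"
  assumes "lin_indep vs" and "length vs < DIM('e)"
  obtains v where "lin_indep (vs @ [v])"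
proof -
  have "span (set vs) \<noteq> UNIV"
    using assms dim_UNIV[where 'a='e] dim_span[of "set vs"] dim_eq_card_independent[of "set vs"]
    by (metis lin_indep_iff distinct_card less_irrefl)
  then obtain v where v: "v \<notin> span (set vs)" by blast
  moreover have "v \<notin> set vs" using v span_base by blast
  ultimately have "lin_indep (vs @ [v])"
    using assms(1) by (simp add: lin_indep_iff independent_insert)
  then show ?thesis by (rule that)
qed

lemma coordinates:
  fixes vs :: "'e::euclidean_space list"
  assumes "lin_indep vs" and "length vs = DIM('e)"
  obtains c :: "nat \<Rightarrow> 'e \<Rightarrow> real" where "\<And>i. linear (c i)"
    and "\<And>u. u = (\<Sum>i<DIM('e). c i u *\<^sub>R vs ! i)"
    and "\<forall>i<DIM('e). \<forall>j<DIM('e). c i (vs ! j) = (if i = j then 1 else 0)"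
proof -
  have d: "distinct vs" and ind: "independent (set vs)"
    using assms by (simp_all add: lin_indep_iff)
  then have sp: "span (set vs) = UNIV"
    using assms(2) card_eq_dim[of "set vs" UNIV] by (auto simp: distinct_card)
  have bij: "bij_betw ((!) vs) {..<DIM('e)} (set vs)"
    using d by (rule bij_betw_nth) (use assms in auto)
  define c where "c i u = representation (set vs) u (vs ! i)" for i u
  show ?thesis
  proof
    show "linear (c i)" for i
      unfolding c_def
      by (rule linearI) (use ind sp in \<open>auto simp: representation_add representation_scale\<close>)
    show "u = (\<Sum>i<DIM('e). c i u *\<^sub>R vs ! i)" for u
      using sum_representation_eq[of "set vs" u "set vs"] ind sp
        sum.reindex_bij_betw[OF bij, of "\<lambda>x. representation (set vs) u x *\<^sub>R x"]
      by (simp add: c_def)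
    show "\<forall>i<DIM('e). \<forall>j<DIM('e). c i (vs ! j) = (if i = j then 1 else 0)"
      using d ind assms(2) by (auto simp: c_def representation_basis nth_eq_iff_index_eq)
  qed
qed

text \<open>The form \<open>\<omega>\<close> is the standard symplectic form that pairs each even-numbered coordinate with the
  next one. All constructions of symplectic forms below choose a basis and then only have to check
  closedness.\<close>

lemma symplectic_form_in_coordinates:
  fixes vs :: "'e::euclidean_space list" and c :: "nat \<Rightarrow> 'e \<Rightarrow> real"
  assumes k: "DIM('e) = 2 * k"
    and c: "\<And>i. linear (c i)"
      "\<And>u. u = (\<Sum>i<DIM('e). c i u *\<^sub>R vs ! i)"
      "\<forall>i<DIM('e). \<forall>j<DIM('e). c i (vs ! j) = (if i = j then 1 else 0)"
  defines "\<omega> \<equiv> \<lambda>u v. \<Sum>i<k. c (2 * i) u * c (2 * i + 1) v - c (2 * i + 1) u * c (2 * i) v"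
  assumes "closed_form b \<omega>"
  shows "symplectic_form b \<omega>"
proof -
  have 1: "two_form \<omega>"
    unfolding two_form_def bilinear_def \<omega>_def
    by (auto intro!: linearI simp: linear_add[OF c(1)] linear_scale[OF c(1)]
        sum_distrib_left sum.distrib[symmetric] algebra_simps)
  have "nondegenerate \<omega>"
    unfolding nondegenerate_def
  proof (intro allI impI)
    fix u assume u: "\<forall>v. \<omega> u v = 0"
    have "c j u = 0" if j: "j < 2 * k" for j
    proof -
      obtain i where i: "j = 2 * i \<or> j = 2 * i + 1" "i < k"
        using j by (metis add.commute div_mult_mod_eq less_mult_imp_div_less mult.commute
            mod2_eq_if add_0)
      \<comment> \<open>Pairing with a basis vector reads off the coordinate of its partner.\<close>
      have "\<omega> u (vs ! (2 * i + 1)) = (\<Sum>l<k. if l = i then c (2 * i) u else 0)"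
        unfolding \<omega>_def by (rule sum.cong) (use i k in \<open>auto simp: c(3)\<close>, presburger?)
      moreover have "\<omega> u (vs ! (2 * i)) = (\<Sum>l<k. if l = i then - c (2 * i + 1) u else 0)"
        unfolding \<omega>_def by (rule sum.cong) (use i k in \<open>auto simp: c(3)\<close>, presburger?)
      ultimately show ?thesis
        using i u by auto
    qed
    then show "u = 0" using c(2)[of u] k by simp
  qed
  then show ?thesis using 1 assms unfolding symplectic_form_def by blast
qed

lemma lin_indep_pair:
  assumes "lin_indep [x, y]" and "s *\<^sub>R x + t *\<^sub>R y = 0"
  shows "s = 0 \<and> t = 0"
proof -
  let ?a = "\<lambda>i::nat. if i = 0 then s else t"
  have "\<forall>i<2. ?a i = 0"
    using assms(1)[unfolded lin_indep_def, rule_format, of ?a] assms(2) by simp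
  then show ?thesis by (auto dest: spec[of _ 0] spec[of _ 1])
qed

lemma lin_indep6I:
  assumes "\<And>a0 a1 a2 a3 a4 a5 :: real.
    a0 *\<^sub>R v0 + a1 *\<^sub>R v1 + a2 *\<^sub>R v2 + a3 *\<^sub>R v3 + a4 *\<^sub>R v4 + a5 *\<^sub>R v5 = 0 \<Longrightarrow>
      a0 = 0 \<and> a1 = 0 \<and> a2 = 0 \<and> a3 = 0 \<and> a4 = 0 \<and> a5 = 0"
  shows "lin_indep [v0, v1, v2, v3, v4, v5]"
  unfolding lin_indep_def
proof (intro allI impI)
  fix a :: "nat \<Rightarrow> real" and i
  let ?vs = "[v0, v1, v2, v3, v4, v5]"
  assume "(\<Sum>i<length ?vs. a i *\<^sub>R ?vs ! i) = 0" and i: "i < length ?vs"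
  then have "a 0 *\<^sub>R v0 + a 1 *\<^sub>R v1 + a 2 *\<^sub>R v2 + a 3 *\<^sub>R v3 + a 4 *\<^sub>R v4 + a 5 *\<^sub>R v5 = 0"
    by (simp add: eval_nat_numeral)
  from assms[OF this] i show "a i = 0"
    by (auto simp: eval_nat_numeral less_Suc_eq)
qed

lemma lin_indep5I:
  assumes "\<And>a0 a1 a2 a3 a4 :: real.
    a0 *\<^sub>R v0 + a1 *\<^sub>R v1 + a2 *\<^sub>R v2 + a3 *\<^sub>R v3 + a4 *\<^sub>R v4 = 0 \<Longrightarrow>
      a0 = 0 \<and> a1 = 0 \<and> a2 = 0 \<and> a3 = 0 \<and> a4 = 0"
  shows "lin_indep [v0, v1, v2, v3, v4]"
  unfolding lin_indep_def
proof (intro allI impI)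
  fix a :: "nat \<Rightarrow> real" and i
  let ?vs = "[v0, v1, v2, v3, v4]"
  assume "(\<Sum>i<length ?vs. a i *\<^sub>R ?vs ! i) = 0" and i: "i < length ?vs"
  then have "a 0 *\<^sub>R v0 + a 1 *\<^sub>R v1 + a 2 *\<^sub>R v2 + a 3 *\<^sub>R v3 + a 4 *\<^sub>R v4 = 0"
    by (simp add: eval_nat_numeral)
  from assms[OF this] i show "a i = 0"
    by (auto simp: eval_nat_numeral less_Suc_eq)
qed

text \<open>This lets a basis be reordered, so that any of its entries can be shifted by
  \<open>lin_indep_shift\<close> and partners stand next to each other as \<open>symplectic_form_in_coordinates\<close>
  requires.\<close>

lemma lin_indep_cong_mset:
  assumes "lin_indep vs" and "mset vs = mset ws"
  shows "lin_indep ws"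
  using assms mset_eq_setD[OF assms(2)] mset_eq_imp_distinct_iff[OF assms(2)]
  by (simp add: lin_indep_iff)

lemma lin_indep_snoc: "lin_indep (vs @ [v]) \<longleftrightarrow> lin_indep vs \<and> v \<notin> span (set vs)"
  using span_base[of v "set vs"] by (auto simp: lin_indep_iff independent_insert)

lemma lin_indep_shift:
  assumes "lin_indep (vs @ [v])" and "w \<in> span (set vs)"
  shows "lin_indep (vs @ [v + w])"
  using assms span_diff[of "v + w" "set vs" w] by (auto simp: lin_indep_snoc)

lemma dependent_pairE:
  assumes "\<not> lin_indep [x, y]" and "x \<noteq> 0"
  obtains r where "y = r *\<^sub>R x"
proof -
  have "lin_indep [x]" using assms(2) by (simp add: lin_indep_iff)
  then have "y \<in> span {x}" using lin_indep_snoc[of "[x]" y] assms(1) by simp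
  then show ?thesis using that by (auto simp: span_singleton)
qed

text \<open>Two independent vectors of a space spanned by two vectors are a basis of it.\<close>

lemma combination_in_plane:
  fixes x y z :: "'e::euclidean_space"
  assumes "lin_indep [x, y]" and "{x, y, z} \<subseteq> span {v, w}"
  obtains s t where "z = s *\<^sub>R x + t *\<^sub>R y"
proof -
  have xy: "x \<noteq> y" "independent {x, y}"
    using assms(1) by (auto simp: lin_indep_iff)
  have "dim (span {v, w}) \<le> 2"
    using dim_le_card'[of "{v, w}"] card_insert_le_m1[of 2 "{w}" v] by simp
  then have "dim (span {v, w}) \<le> card {x, y}"
    using xy(1) by simp
  moreover have "{x, y} \<subseteq> span {v, w}" using assms(2) by blast
  ultimately have "span {v, w} \<subseteq> span {x, y}"
    using card_ge_dim_independent xy(2) by blast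
  then have "z \<in> span {x, y}" using assms(2) by blast
  then obtain s t where "z = s *\<^sub>R x + t *\<^sub>R y"
    by (auto simp: span_insert span_singleton algebra_simps)
  then show ?thesis by (rule that)
qed

text \<open>The statements of \<open>coordinates\<close> without indexed sums: existence and uniqueness of the
  coefficients of a vector in a basis of six vectors.\<close>

lemma coordinates6:
  fixes v0 :: "'e::euclidean_space" and c :: "nat \<Rightarrow> 'e \<Rightarrow> real"
  assumes dim: "DIM('e) = 6" and lin: "\<And>i. linear (c i)"
    and comb: "\<And>u. u = (\<Sum>i<DIM('e). c i u *\<^sub>R [v0, v1, v2, v3, v4, v5] ! i)"
    and dual: "\<forall>i<DIM('e). \<forall>j<DIM('e).
      c i ([v0, v1, v2, v3, v4, v5] ! j) = (if i = j then 1 else 0)"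
  shows "u = c 0 u *\<^sub>R v0 + c 1 u *\<^sub>R v1 + c 2 u *\<^sub>R v2 + c 3 u *\<^sub>R v3 + c 4 u *\<^sub>R v4 + c 5 u *\<^sub>R v5"
    and "u = a0 *\<^sub>R v0 + a1 *\<^sub>R v1 + a2 *\<^sub>R v2 + a3 *\<^sub>R v3 + a4 *\<^sub>R v4 + a5 *\<^sub>R v5 \<Longrightarrow>
      c 0 u = a0 \<and> c 1 u = a1 \<and> c 2 u = a2 \<and> c 3 u = a3 \<and> c 4 u = a4 \<and> c 5 u = a5"
proof -
  show "u = c 0 u *\<^sub>R v0 + c 1 u *\<^sub>R v1 + c 2 u *\<^sub>R v2 + c 3 u *\<^sub>R v3 + c 4 u *\<^sub>R v4 + c 5 u *\<^sub>R v5"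
    using comb[of u] dim by (simp add: eval_nat_numeral)
  have *: "c i v0 = (if i = 0 then 1 else 0)" "c i v1 = (if i = 1 then 1 else 0)"
    "c i v2 = (if i = 2 then 1 else 0)" "c i v3 = (if i = 3 then 1 else 0)"
    "c i v4 = (if i = 4 then 1 else 0)" "c i v5 = (if i = 5 then 1 else 0)" if "i < 6" for i
    using that dual[rule_format, of i 0] dual[rule_format, of i 1] dual[rule_format, of i 2] dual[rule_format, of i 3] dual[rule_format, of i 4] dual[rule_format, of i 5] dim
    by simp_all
  assume u: "u = a0 *\<^sub>R v0 + a1 *\<^sub>R v1 + a2 *\<^sub>R v2 + a3 *\<^sub>R v3 + a4 *\<^sub>R v4 + a5 *\<^sub>R v5"
  show "c 0 u = a0 \<and> c 1 u = a1 \<and> c 2 u = a2 \<and> c 3 u = a3 \<and> c 4 u = a4 \<and> c 5 u = a5"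
    unfolding u by (simp add: linear_add[OF lin] linear_scale[OF lin] *)
qed

lemma symplectic_form6I:
  fixes b :: "'e::euclidean_space \<Rightarrow> 'e \<Rightarrow> 'e"
  assumes dim: "DIM('e) = 6" and ind: "lin_indep [v0, v1, v2, v3, v4, v5]"
    and closed: "\<And>c0 c1 c2 c3 c4 c5 :: 'e \<Rightarrow> real.
      (\<And>u. u = c0 u *\<^sub>R v0 + c1 u *\<^sub>R v1 + c2 u *\<^sub>R v2 + c3 u *\<^sub>R v3 + c4 u *\<^sub>R v4 + c5 u *\<^sub>R v5) \<Longrightarrow>
      (\<And>a0 a1 a2 a3 a4 a5 u.
        u = a0 *\<^sub>R v0 + a1 *\<^sub>R v1 + a2 *\<^sub>R v2 + a3 *\<^sub>R v3 + a4 *\<^sub>R v4 + a5 *\<^sub>R v5 \<Longrightarrow>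
        c0 u = a0 \<and> c1 u = a1 \<and> c2 u = a2 \<and> c3 u = a3 \<and> c4 u = a4 \<and> c5 u = a5) \<Longrightarrow>
      closed_form b (\<lambda>u v. (c0 u * c1 v - c1 u * c0 v) + (c2 u * c3 v - c3 u * c2 v)
        + (c4 u * c5 v - c5 u * c4 v))"
  shows "\<exists>\<omega>. symplectic_form b \<omega>"
proof -
  let ?vs = "[v0, v1, v2, v3, v4, v5]"
  have len: "length ?vs = DIM('e)" using dim by simp
  show ?thesis
  proof (rule coordinates[OF ind len])
    fix c assume c: "\<And>i. linear (c i)" "\<And>u. u = (\<Sum>i<DIM('e). c i u *\<^sub>R ?vs ! i)"
      "\<forall>i<DIM('e). \<forall>j<DIM('e). c i (?vs ! j) = (if i = j then 1 else 0)"
    have "closed_form b (\<lambda>u v. (c 0 u * c 1 v - c 1 u * c 0 v) + (c 2 u * c 3 v - c 3 u * c 2 v)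
        + (c 4 u * c 5 v - c 5 u * c 4 v))"
      using coordinates6[OF dim c] by (rule closed)
    then have "closed_form b (\<lambda>u v. \<Sum>i<3. c (2 * i) u * c (2 * i + 1) v - c (2 * i + 1) u * c (2 * i) v)"
      by (simp add: eval_nat_numeral)
    then show ?thesis
      using symplectic_form_in_coordinates[of 3 c ?vs b, OF _ c] dim by auto
  qed
qed

lemma combination6:
  fixes u :: "'e::euclidean_space"
  assumes "DIM('e) = 6" and "lin_indep [v0, v1, v2, v3, v4, v5]"
  obtains a0 a1 a2 a3 a4 a5
  where "u = a0 *\<^sub>R v0 + a1 *\<^sub>R v1 + a2 *\<^sub>R v2 + a3 *\<^sub>R v3 + a4 *\<^sub>R v4 + a5 *\<^sub>R v5"
proof -
  have len: "length [v0, v1, v2, v3, v4, v5] = DIM('e)" using assms(1) by simp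
  show ?thesis
  proof (rule coordinates[OF assms(2) len])
    fix c assume "\<And>u. u = (\<Sum>i<DIM('e). c i u *\<^sub>R [v0, v1, v2, v3, v4, v5] ! i)"
    from this[of u] show ?thesis
      using assms(1) by (intro that) (simp add: eval_nat_numeral)
  qed
qed

section \<open>Two-step nilpotent Lie algebras\<close>

locale two_step_lie_algebra =
  fixes b :: "'e::euclidean_space \<Rightarrow> 'e \<Rightarrow> 'e"
  assumes bil: "bilinear b" and self [simp]: "b u u = 0" and two_step: "two_step_nilpotent b"
begin

lemma nil [simp]: "b (b u v) w = 0"
  using two_step by (simp add: two_step_nilpotent_def)

lemmas expand = bilinear_ladd[OF bil] bilinear_radd[OF bil] bilinear_lsub[OF bil]
  bilinear_rsub[OF bil] bilinear_lmul[OF bil] bilinear_rmul[OF bil]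
  bilinear_lneg[OF bil] bilinear_rneg[OF bil]

lemma zero [simp]: "b 0 u = 0" "b u 0 = 0"
  by (simp_all add: bilinear_lzero[OF bil] bilinear_rzero[OF bil])

lemma antisym: "b u v = - b v u"
proof -
  have "b (u + v) (u + v) = 0" by (rule self)
  then show ?thesis by (simp add: expand eq_neg_iff_add_eq_0 del: self) (simp add: add.commute)
qed

lemma nil' [simp]: "b u (b v w) = 0"
  using antisym[of u "b v w"] by simp

text \<open>Closedness makes \<open>[\<nn>,\<nn>]\<close> orthogonal to the center \<open>\<zz>\<close>, but \<open>\<omega>\<close> itself need not be isotropic
  on \<open>\<zz>\<close>. Let \<open>Q\<close> kill a complement of \<open>[\<nn>,\<nn>]\<close> in \<open>\<zz>\<close> and fix \<open>[\<nn>,\<nn>]\<close> and a complement of \<open>\<zz>\<close>.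
  It changes vectors only by central ones, so it respects brackets and the pullback of \<open>\<omega>\<close> is
  closed; it maps \<open>\<zz>\<close> into \<open>[\<nn>,\<nn>]\<close>, so the pullback vanishes on \<open>\<zz>\<close>. A nonzero bracket is still paired
  nontrivially, because \<open>\<omega>\<close> pairs it to zero with the central part that \<open>Q\<close> removes.\<close>

lemma closed_type_II_if_symplectic:
  assumes "symplectic_form b \<omega>"
  shows "\<exists>\<omega>'. two_form \<omega>' \<and> closed_form b \<omega>' \<and> type_II b \<omega>'"
proof -
  have \<omega>: "bilinear \<omega>" "\<And>u. \<omega> u u = 0"
    and closed: "\<And>u v w. \<omega> (b u v) w + \<omega> (b v w) u + \<omega> (b w u) v = 0"
    and nondeg: "\<And>u. (\<And>v. \<omega> u v = 0) \<Longrightarrow> u = 0"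
    using assms by (auto simp: symplectic_form_def two_form_def closed_form_def nondegenerate_def)
  have \<omega>_zero: "\<omega> 0 u = 0" "\<omega> u 0 = 0" for u
    by (simp_all add: bilinear_lzero[OF \<omega>(1)] bilinear_rzero[OF \<omega>(1)])
  let ?Z = "lie_center b"
  define D where "D = span (range (\<lambda>(u, v). b u v))"
  have Z: "subspace ?Z"
    by (auto simp: subspace_def lie_center_def expand)
  have D_sub: "D \<subseteq> ?Z"
    unfolding D_def by (rule span_minimal[OF _ Z]) (auto simp: lie_center_def)
  have D_orth: "\<omega> d z = 0" if "d \<in> D" "z \<in> ?Z" for d z
  proof -
    have "b z u = 0" "b u z = 0" for u
      using that(2) antisym[of u z] by (auto simp: lie_center_def)
    then have "\<omega> (b u v) z = 0" for u v
      using closed[of u v z] by (simp add: \<omega>_zero)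
    then have "range (\<lambda>(u, v). b u v) \<subseteq> {d. \<omega> d z = 0}" by auto
    moreover have "subspace {d. \<omega> d z = 0}"
      by (auto simp: subspace_def \<omega>_zero bilinear_ladd[OF \<omega>(1)] bilinear_lmul[OF \<omega>(1)])
    ultimately show ?thesis using that(1) span_minimal unfolding D_def by blast
  qed
  have ex_proj: "\<exists>P. linear P \<and> range P \<subseteq> S \<and> (\<forall>x\<in>S. P x = x)" if "subspace S" for S :: "'e set"
    using linear_exists_left_inverse_on[OF linear_id that]
    by (auto simp: id_def linear_iff inj_on_def)
  obtain P where P: "linear P" "range P \<subseteq> ?Z" "\<And>z. z \<in> ?Z \<Longrightarrow> P z = z"
    using ex_proj[OF Z] by blast
  obtain R where R: "linear R" "range R \<subseteq> D" "\<And>z. z \<in> D \<Longrightarrow> R z = z"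
    using ex_proj[of D] by (auto simp: D_def)
  \<comment> \<open>\<open>P\<close> projects onto the center and \<open>R\<close> onto the derived algebra.\<close>
  define Q where "Q u = u - P u + R (P u)" for u
  have Q: "linear Q"
    using linear_compose_add[OF linear_compose_sub[OF linear_ident P(1)] linear_compose[OF P(1) R(1)]]
    by (simp add: Q_def[abs_def] o_def)
  have Q_D: "Q d = d" if "d \<in> D" for d
    using that D_sub P(3) R(3) by (auto simp: Q_def)
  have Q_Z: "Q z \<in> D" if "z \<in> ?Z" for z
    using that P(3) R(2) by (auto simp: Q_def)
  have diff_Z: "u - Q u \<in> ?Z" for u
  proof -
    have "u - Q u = P u - R (P u)" by (simp add: Q_def)
    then show ?thesis
      using P(2) R(2) D_sub subspace_diff[OF Z, of "P u" "R (P u)"] by auto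
  qed
  have b_D: "b u v \<in> D" for u v
    unfolding D_def by (rule span_base) auto
  have Q_hom: "Q (b u v) = b (Q u) (Q v)" for u v
  proof -
    have "b (u - Q u) v = 0" "b (v - Q v) (Q u) = 0"
      using diff_Z by (auto simp: lie_center_def)
    then have "b u v = b (Q u) v" "b (Q u) v = b (Q u) (Q v)"
      using antisym[of v "Q u"] antisym[of "Q v" "Q u"] by (auto simp: expand)
    then show ?thesis using Q_D[OF b_D] by simp
  qed
  define \<omega>' where "\<omega>' u v = \<omega> (Q u) (Q v)" for u v
  have "two_form \<omega>'"
    unfolding two_form_def bilinear_def \<omega>'_def
    using \<omega>(2) by (auto intro!: linearI simp: linear_add[OF Q] linear_scale[OF Q]
        bilinear_ladd[OF \<omega>(1)] bilinear_lmul[OF \<omega>(1)] bilinear_radd[OF \<omega>(1)] bilinear_rmul[OF \<omega>(1)])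
  moreover have "closed_form b \<omega>'"
    by (simp add: closed_form_def \<omega>'_def Q_hom closed)
  moreover have "type_II b \<omega>'"
  proof -
    have "\<omega>' z z' = 0" if "z \<in> ?Z" "z' \<in> ?Z" for z z'
      unfolding \<omega>'_def using D_orth[OF Q_Z[OF that(1)]] Q_Z[OF that(2)] D_sub by blast
    moreover obtain x y where "b x y \<noteq> 0"
      using two_step by (auto simp: two_step_nilpotent_def)
    then obtain u where u: "\<omega> (b x y) u \<noteq> 0" using nondeg by blast
    have "\<omega> (b x y) (u - Q u) = 0" by (rule D_orth[OF b_D diff_Z])
    then have "\<omega>' (b x y) u \<noteq> 0"
      using u by (simp add: \<omega>'_def Q_D[OF b_D] bilinear_rsub[OF \<omega>(1)])
    moreover have "b x y \<in> ?Z" by (simp add: lie_center_def)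
    ultimately show ?thesis unfolding type_II_def by blast
  qed
  ultimately show ?thesis by blast
qed

text \<open>Closedness for \<open>e1, e2, w\<close> expresses \<open>\<omega> z w\<close> through \<open>\<omega> z e1\<close> and \<open>\<omega> z e2\<close>. These vanish by
  closedness for the second pair together with \<open>e1\<close> or \<open>e2\<close>, as \<open>z\<close> is also the bracket of \<open>e3\<close>
  and \<open>e4\<close>. One pair alone would not suffice, and indeed \<open>h\<^sub>1(\<real>) \<oplus> \<real>\<close> is symplectic.\<close>

lemma closed_form_kernel:
  assumes "two_form \<omega>" "closed_form b \<omega>"
    and "b e1 e2 = z" "b e3 e4 = z" "b e1 e3 = 0" "b e1 e4 = 0" "b e2 e3 = 0" "b e2 e4 = 0"
    and line: "\<And>u v. \<exists>r. b u v = r *\<^sub>R z"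
  shows "\<omega> z w = 0"
proof -
  have \<omega>: "bilinear \<omega>"
    and closed: "\<And>u v w. \<omega> (b u v) w + \<omega> (b v w) u + \<omega> (b w u) v = 0"
    using assms by (auto simp: two_form_def closed_form_def)
  have 0: "\<omega> 0 u = 0" for u by (rule bilinear_lzero[OF \<omega>])
  have "\<omega> z e1 = 0" "\<omega> z e2 = 0"
    using closed[of e3 e4 e1] closed[of e3 e4 e2] antisym[of e4 e1] antisym[of e4 e2] assms
    by (simp_all add: 0)
  moreover obtain r s where "b e2 w = r *\<^sub>R z" "b w e1 = s *\<^sub>R z" using line by metis
  ultimately show ?thesis
    using closed[of e1 e2 w] assms by (simp add: bilinear_lmul[OF \<omega>])
qed

section \<open>Algebras with a bracket map of rank two\<close>

text \<open>The coefficient \<open>q\<close> is removed by passing from \<open>g\<close> to \<open>h = g - q e1\<close>, since \<open>[e1,e3] = f2\<close>.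
  The form is then \<open>e\<^sup>1 \<and> f\<^sup>2 + h\<^sup>* \<and> f\<^sup>1 + e\<^sup>2 \<and> e\<^sup>3\<close>: in the cyclic sum for \<open>e1, e2, h\<close>, the only one
  with nonzero terms, the contributions of \<open>[e1,e2] = f1\<close> paired with \<open>h\<close> and of the
  \<open>f2\<close>-component of \<open>[e2,h]\<close> paired with \<open>e1\<close> cancel.\<close>

lemma symplectic_if_noncentral:
  assumes dim: "DIM('e) = 6" and ind: "lin_indep [f1, f2]"
    and br: "b e1 e2 = f1" "b e1 e3 = f2" "b g e2 = f2" "b e1 g = 0" "b e2 e3 = 0"
      "b g e3 = p *\<^sub>R f1 + q *\<^sub>R f2"
  shows "\<exists>\<omega>. symplectic_form b \<omega>"
proof -
  define h where "h = g - q *\<^sub>R e1"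
  have f: "b f1 u = 0" "b f2 u = 0" "b u f1 = 0" "b u f2 = 0" for u
    using br by (auto simp flip: br)
  have br': "b e1 e2 = f1" "b e1 e3 = f2" "b h e2 = f2 - q *\<^sub>R f1" "b e1 h = 0" "b e2 e3 = 0"
    "b h e3 = p *\<^sub>R f1"
    by (simp_all add: h_def expand br)
  have br'': "b e2 e1 = - f1" "b e3 e1 = - f2" "b e2 h = q *\<^sub>R f1 - f2" "b h e1 = 0" "b e3 e2 = 0"
    "b e3 h = - (p *\<^sub>R f1)"
    by (subst antisym, simp add: br')+
  note tab = br' br'' f
  show ?thesis
  proof (rule symplectic_form6I[OF dim, of e1 f2 h f1 e2 e3])
    show "lin_indep [e1, f2, h, f1, e2, e3]"
    proof (rule lin_indep6I)
      fix a0 a1 a2 a3 a4 a5 :: real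
      assume 0: "a0 *\<^sub>R e1 + a1 *\<^sub>R f2 + a2 *\<^sub>R h + a3 *\<^sub>R f1 + a4 *\<^sub>R e2 + a5 *\<^sub>R e3 = 0"
      then have "b e1 (a0 *\<^sub>R e1 + a1 *\<^sub>R f2 + a2 *\<^sub>R h + a3 *\<^sub>R f1 + a4 *\<^sub>R e2 + a5 *\<^sub>R e3) = 0"
        by simp
      then have 1: "a4 = 0 \<and> a5 = 0"
        by (intro lin_indep_pair[OF ind]) (simp add: expand tab)
      from 0 have "b (a0 *\<^sub>R e1 + a1 *\<^sub>R f2 + a2 *\<^sub>R h + a3 *\<^sub>R f1 + a4 *\<^sub>R e2 + a5 *\<^sub>R e3) e2 = 0"
        by simp
      then have 2: "a0 - a2 * q = 0 \<and> a2 = 0"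
        using 1 by (intro lin_indep_pair[OF ind]) (simp add: expand tab algebra_simps)
      have "a3 = 0 \<and> a1 = 0"
        using 0 1 2 by (intro lin_indep_pair[OF ind]) (simp add: algebra_simps)
      with 1 2 show "a0 = 0 \<and> a1 = 0 \<and> a2 = 0 \<and> a3 = 0 \<and> a4 = 0 \<and> a5 = 0" by simp
    qed
  next
    fix c0 c1 c2 c3 c4 c5 :: "'e \<Rightarrow> real"
    assume c: "\<And>u. u = c0 u *\<^sub>R e1 + c1 u *\<^sub>R f2 + c2 u *\<^sub>R h + c3 u *\<^sub>R f1 + c4 u *\<^sub>R e2 + c5 u *\<^sub>R e3"
      and coords: "\<And>a0 a1 a2 a3 a4 a5 u.
        u = a0 *\<^sub>R e1 + a1 *\<^sub>R f2 + a2 *\<^sub>R h + a3 *\<^sub>R f1 + a4 *\<^sub>R e2 + a5 *\<^sub>R e3 \<Longrightarrow>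
        c0 u = a0 \<and> c1 u = a1 \<and> c2 u = a2 \<and> c3 u = a3 \<and> c4 u = a4 \<and> c5 u = a5"
    have "b u v = 0 *\<^sub>R e1
      + (c0 u * c5 v - c5 u * c0 v + (c2 u * c4 v - c4 u * c2 v)) *\<^sub>R f2
      + 0 *\<^sub>R h
      + (c0 u * c4 v - c4 u * c0 v - q * (c2 u * c4 v - c4 u * c2 v)
          + p * (c2 u * c5 v - c5 u * c2 v)) *\<^sub>R f1
      + 0 *\<^sub>R e2 + 0 *\<^sub>R e3" for u v
      by (subst c[of u], subst c[of v]) (simp add: expand tab algebra_simps)
    note b_coords = coords[OF this]
    show "closed_form b (\<lambda>u v. (c0 u * c1 v - c1 u * c0 v)
        + (c2 u * c3 v - c3 u * c2 v) + (c4 u * c5 v - c5 u * c4 v))"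
      unfolding closed_form_def by (simp add: b_coords) (simp add: algebra_simps)
  qed
qed

text \<open>The form is \<open>e\<^sup>1 \<and> f\<^sup>1 + e\<^sup>3 \<and> f\<^sup>2 + e\<^sup>2 \<and> g\<^sup>*\<close>. Closedness matters only for \<open>e1, e2, e3\<close>, where
  each bracket has components only along partners of the two vectors that form it, so that its pairing
  with the third vector is zero.\<close>

lemma symplectic_if_central:
  assumes dim: "DIM('e) = 6" and ind: "lin_indep [e1, f1, e3, f2, e2, g]"
    and br: "b e1 e2 = f1" "b e1 e3 = f2" "b e2 e3 = q *\<^sub>R f2 + r *\<^sub>R g"
    and g: "\<And>u. b g u = 0"
  shows "\<exists>\<omega>. symplectic_form b \<omega>"
proof -
  have g': "b u g = 0" for u
    using g antisym[of u g] by simp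
  have f: "b f1 u = 0" "b f2 u = 0" "b u f1 = 0" "b u f2 = 0" for u
    by (simp_all flip: br(1,2))
  have br': "b e2 e1 = - f1" "b e3 e1 = - f2" "b e3 e2 = - (q *\<^sub>R f2 + r *\<^sub>R g)"
    by (subst antisym, simp add: br)+
  note tab = br br' f g g'
  show ?thesis
  proof (rule symplectic_form6I[OF dim ind])
    fix c0 c1 c2 c3 c4 c5 :: "'e \<Rightarrow> real"
    assume c: "\<And>u. u = c0 u *\<^sub>R e1 + c1 u *\<^sub>R f1 + c2 u *\<^sub>R e3 + c3 u *\<^sub>R f2 + c4 u *\<^sub>R e2 + c5 u *\<^sub>R g"
      and coords: "\<And>a0 a1 a2 a3 a4 a5 u.
        u = a0 *\<^sub>R e1 + a1 *\<^sub>R f1 + a2 *\<^sub>R e3 + a3 *\<^sub>R f2 + a4 *\<^sub>R e2 + a5 *\<^sub>R g \<Longrightarrow>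
        c0 u = a0 \<and> c1 u = a1 \<and> c2 u = a2 \<and> c3 u = a3 \<and> c4 u = a4 \<and> c5 u = a5"
    have "b u v = 0 *\<^sub>R e1
      + (c0 u * c4 v - c4 u * c0 v) *\<^sub>R f1
      + 0 *\<^sub>R e3
      + (c0 u * c2 v - c2 u * c0 v + q * (c4 u * c2 v - c2 u * c4 v)) *\<^sub>R f2
      + 0 *\<^sub>R e2
      + (r * (c4 u * c2 v - c2 u * c4 v)) *\<^sub>R g" for u v
      by (subst c[of u], subst c[of v]) (simp add: expand tab algebra_simps)
    note b_coords = coords[OF this]
    show "closed_form b (\<lambda>u v. (c0 u * c1 v - c1 u * c0 v)
        + (c2 u * c3 v - c3 u * c2 v) + (c4 u * c5 v - c5 u * c4 v))"
      unfolding closed_form_def by (simp add: b_coords) (simp add: algebra_simps)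
  qed
qed

text \<open>Bracketing a relation with \<open>e1\<close> and then with \<open>e2\<close> shows that \<open>e1, e2, e3, f1, f2\<close> are
  independent, so evenness forces dimension six and a single vector \<open>g\<close> completes the basis. The same
  two brackets determine the coefficients of central vectors: the bracket of \<open>e1\<close> with the last basis
  vector lies in the plane of \<open>f1, f2\<close>, so \<open>g\<close> can be chosen to commute with \<open>e1\<close>, and the center
  exceeds that plane only if it contains some \<open>g + l e1\<close>. In the latter case
  \<open>symplectic_if_central\<close> applies after a shift of \<open>e3\<close> along \<open>e1\<close>.

  Otherwise compare \<open>[g,\<cdot>]\<close> with \<open>[e1,\<cdot>]\<close> on the plane of \<open>e2, e3\<close>. If they were dependent at every
  vector, they would be proportional and a combination of \<open>g\<close> and \<open>e1\<close> would be central. So some \<open>U\<close>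
  has independent brackets with \<open>e1\<close> and \<open>g\<close>; choosing \<open>V\<close> with \<open>[e1,V] = [g,U]\<close> leads to
  \<open>symplectic_if_noncentral\<close>.\<close>

lemma symplectic_if_ad_rank_two:
  assumes dim: "even (DIM('e))" "DIM('e) \<le> 6" and ind: "lin_indep [b e1 e2, b e1 e3]"
  shows "\<exists>\<omega>. symplectic_form b \<omega>"
proof -
  define f1 f2 where "f1 = b e1 e2" and "f2 = b e1 e3"
  have ind: "lin_indep [f1, f2]" using ind by (simp add: f1_def f2_def)
  have f: "b f1 u = 0" "b f2 u = 0" "b u f1 = 0" "b u f2 = 0" for u
    by (simp_all add: f1_def f2_def)
  have br: "b e1 e2 = f1" "b e1 e3 = f2" "b e2 e1 = - f1" "b e3 e1 = - f2"
    using antisym[of e2 e1] antisym[of e3 e1] by (simp_all add: f1_def f2_def)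
  note tab = br f
  have f1_nz: "f1 \<noteq> 0"
    using lin_indep_pair[OF ind, of 1 0] by auto
  have ind5: "lin_indep [e1, e2, e3, f1, f2]"
  proof (rule lin_indep5I)
    fix a0 a1 a2 a3 a4 :: real
    assume 0: "a0 *\<^sub>R e1 + a1 *\<^sub>R e2 + a2 *\<^sub>R e3 + a3 *\<^sub>R f1 + a4 *\<^sub>R f2 = 0" (is "?s = 0")
    have "b e1 ?s = 0" using 0 by simp
    then have 1: "a1 = 0 \<and> a2 = 0"
      by (intro lin_indep_pair[OF ind]) (simp add: expand tab)
    have "b ?s e2 = 0" using 0 by simp
    then have 2: "a0 = 0" using 1 f1_nz by (simp add: expand tab)
    have "a3 = 0 \<and> a4 = 0"
      using 0 1 2 by (intro lin_indep_pair[OF ind]) simp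
    with 1 2 show "a0 = 0 \<and> a1 = 0 \<and> a2 = 0 \<and> a3 = 0 \<and> a4 = 0" by simp
  qed
  have "5 \<le> DIM('e)" using lin_indep_length_le[OF ind5] by simp
  with dim have dim: "DIM('e) = 6" by presburger
  obtain g0 where ind0: "lin_indep [e1, e2, e3, f1, f2, g0]"
    using lin_indep_extend[OF ind5] dim by auto
  have "\<exists>s t. b e1 g0 = s *\<^sub>R f1 + t *\<^sub>R f2"
  proof -
    obtain a0 a1 a2 a3 a4 a5 where
      a: "b e1 g0 = a0 *\<^sub>R e1 + a1 *\<^sub>R e2 + a2 *\<^sub>R e3 + a3 *\<^sub>R f1 + a4 *\<^sub>R f2 + a5 *\<^sub>R g0"
      using combination6[OF dim ind0] .
    have 1: "a5 *\<^sub>R b e1 g0 + a1 *\<^sub>R f1 + a2 *\<^sub>R f2 = 0"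
      using arg_cong[OF a, of "b e1"] by (simp add: expand tab algebra_simps)
    show ?thesis
    proof (cases "a5 = 0")
      case True
      then have 2: "a1 = 0 \<and> a2 = 0"
        using 1 by (intro lin_indep_pair[OF ind]) simp
      have "b (b e1 g0) e2 = 0" by simp
      then have "a0 = 0"
        using True 2 f1_nz by (subst (asm) a) (simp add: expand tab)
      then show ?thesis using a True 2 by auto
    next
      case False
      have "b e1 g0 = (1 / a5) *\<^sub>R (a5 *\<^sub>R b e1 g0)" using False by simp
      also have "a5 *\<^sub>R b e1 g0 = - (a1 *\<^sub>R f1) - a2 *\<^sub>R f2"
        using 1 by (simp add: algebra_simps eq_neg_iff_add_eq_0)
      finally have "b e1 g0 = (- a1 / a5) *\<^sub>R f1 + (- a2 / a5) *\<^sub>R f2"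
        by (simp add: algebra_simps)
      then show ?thesis by blast
    qed
  qed
  then obtain s t where st: "b e1 g0 = s *\<^sub>R f1 + t *\<^sub>R f2" by blast
  define g where "g = g0 + (- (s *\<^sub>R e2) - t *\<^sub>R e3)"
  have "lin_indep ([e1, e2, e3, f1, f2] @ [g0])" using ind0 by simp
  from lin_indep_shift[OF this, of "- (s *\<^sub>R e2) - t *\<^sub>R e3"]
  have ind6: "lin_indep ([e1, e2, e3, f1, f2] @ [g])"
    unfolding g_def by (simp add: span_base span_diff span_neg span_scale)
  have e1g: "b e1 g = 0" "b g e1 = 0"
    using antisym[of g e1] by (simp_all add: g_def expand tab st)
  show ?thesis
  proof (cases "\<exists>l. \<forall>u. b (g + l *\<^sub>R e1) u = 0")
    case True
    then obtain l where l: "\<And>u. b (g + l *\<^sub>R e1) u = 0" by blast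
    define h where "h = g + l *\<^sub>R e1"
    have h: "b h u = 0" for u using l by (simp add: h_def)
    have h': "b u h = 0" for u using h antisym[of u h] by simp
    have indh: "lin_indep [e1, e2, e3, f1, f2, h]"
      using lin_indep_shift[OF ind6, of "l *\<^sub>R e1"] by (simp add: h_def span_base span_scale)
    obtain a0 a1 a2 a3 a4 a5 where
      a: "b e2 e3 = a0 *\<^sub>R e1 + a1 *\<^sub>R e2 + a2 *\<^sub>R e3 + a3 *\<^sub>R f1 + a4 *\<^sub>R f2 + a5 *\<^sub>R h"
      using combination6[OF dim indh] .
    have "b e1 (b e2 e3) = 0" by simp
    then have 1: "a1 = 0 \<and> a2 = 0"
      by (intro lin_indep_pair[OF ind], subst (asm) a) (simp add: expand tab h' algebra_simps)
    have "b (b e2 e3) e2 = 0" by simp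
    then have 2: "a0 = 0"
      using 1 f1_nz by (subst (asm) a) (simp add: expand tab h)
    \<comment> \<open>The shift removes the \<open>f1\<close>-component of the bracket with \<open>e2\<close>, because \<open>[e2,e1] = -f1\<close>.\<close>
    define e3' where "e3' = e3 + a3 *\<^sub>R e1"
    have "lin_indep ([e1, e2, f1, f2, h] @ [e3])"
      by (rule lin_indep_cong_mset[OF indh]) simp
    from lin_indep_shift[OF this, of "a3 *\<^sub>R e1"]
    have "lin_indep ([e1, e2, f1, f2, h] @ [e3'])"
      by (simp add: e3'_def span_base span_scale)
    then have "lin_indep [e1, f1, e3', f2, e2, h]"
      by (rule lin_indep_cong_mset) simp
    then show ?thesis
      by (rule symplectic_if_central[OF dim, where q = a4 and r = a5])
        (use a 1 2 h in \<open>simp_all add: e3'_def expand tab\<close>)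
  next
    case False
    have derived: "b u v \<in> span {f1, f2}" for u v
    proof -
      obtain a0 a1 a2 a3 a4 a5 where
        a: "b u v = a0 *\<^sub>R e1 + a1 *\<^sub>R e2 + a2 *\<^sub>R e3 + a3 *\<^sub>R f1 + a4 *\<^sub>R f2 + a5 *\<^sub>R g"
        using combination6[OF dim ind6[simplified]] .
      have "b e1 (b u v) = 0" by simp
      then have 1: "a1 = 0 \<and> a2 = 0"
        by (intro lin_indep_pair[OF ind], subst (asm) a) (simp add: expand tab e1g algebra_simps)
      have 5: "a5 = 0"
      proof (rule ccontr)
        assume a5: "a5 \<noteq> 0"
        have "b (g + (a0 / a5) *\<^sub>R e1) w = 0" for w
        proof -
          have "a5 *\<^sub>R b (g + (a0 / a5) *\<^sub>R e1) w = b (b u v) w"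
            using a5 1 by (subst a) (simp add: expand tab algebra_simps)
          then show ?thesis using a5 by simp
        qed
        then show False using False by blast
      qed
      have "b (b u v) e2 = 0" by simp
      then have "a0 = 0"
        using 1 5 f1_nz by (subst (asm) a) (simp add: expand tab)
      then show ?thesis
        using a 1 5 by (simp add: span_add span_base span_scale)
    qed
    \<comment> \<open>If \<open>[g,\<cdot>]\<close> multiplies \<open>[e1,\<cdot>]\<close> by a factor at each of \<open>e2\<close>, \<open>e3\<close> and \<open>e2 + e3\<close>, the three
      factors agree.\<close>
    have "\<exists>x y. lin_indep [b e1 (x *\<^sub>R e2 + y *\<^sub>R e3), b g (x *\<^sub>R e2 + y *\<^sub>R e3)]"
    proof (rule ccontr)
      assume "\<not> ?thesis"
      then have dep: "\<And>x y. \<not> lin_indep [b e1 (x *\<^sub>R e2 + y *\<^sub>R e3), b g (x *\<^sub>R e2 + y *\<^sub>R e3)]"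
        by blast
      have "f2 \<noteq> 0" "f1 + f2 \<noteq> 0"
        using lin_indep_pair[OF ind, of 0 1] lin_indep_pair[OF ind, of 1 1] by auto
      then obtain r1 r2 r3 where r: "b g e2 = r1 *\<^sub>R f1" "b g e3 = r2 *\<^sub>R f2"
        "b g (e2 + e3) = r3 *\<^sub>R (f1 + f2)"
        using dependent_pairE[OF dep[of 1 0]] dependent_pairE[OF dep[of 0 1]]
          dependent_pairE[OF dep[of 1 1]] f1_nz by (simp add: expand tab) metis
      then have "(r1 - r3) *\<^sub>R f1 + (r2 - r3) *\<^sub>R f2 = 0"
        by (simp add: expand algebra_simps)
      from lin_indep_pair[OF ind this] have eq: "r1 = r3" "r2 = r3" by simp_all
      have "b (g + (- r3) *\<^sub>R e1) u = 0" for u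
      proof -
        obtain a0 a1 a2 a3 a4 a5 where
          u: "u = a0 *\<^sub>R e1 + a1 *\<^sub>R e2 + a2 *\<^sub>R e3 + a3 *\<^sub>R f1 + a4 *\<^sub>R f2 + a5 *\<^sub>R g"
          using combination6[OF dim ind6[simplified]] .
        show ?thesis
          unfolding u by (simp add: expand tab e1g r eq)
      qed
      then show False using False by blast
    qed
    then obtain x y where xy:
      "lin_indep [b e1 (x *\<^sub>R e2 + y *\<^sub>R e3), b g (x *\<^sub>R e2 + y *\<^sub>R e3)]" by blast
    define U where "U = x *\<^sub>R e2 + y *\<^sub>R e3"
    have ind': "lin_indep [b e1 U, b g U]" using xy by (simp add: U_def)
    obtain s t where st: "b g U = s *\<^sub>R f1 + t *\<^sub>R f2"
      using combination_in_plane[OF ind, of "b g U" f1 f2] derived by (auto simp: span_base)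
    define V where "V = s *\<^sub>R e2 + t *\<^sub>R e3"
    have V: "b e1 V = b g U" by (simp add: V_def expand tab st)
    obtain p q where pq: "b U V = p *\<^sub>R b e1 U + q *\<^sub>R b g U"
      using combination_in_plane[OF ind', of "b U V" f1 f2] derived by auto
    obtain p' q' where pq': "b g V = p' *\<^sub>R b e1 U + q' *\<^sub>R b g U"
      using combination_in_plane[OF ind', of "b g V" f1 f2] derived by auto
    \<comment> \<open>Shifting \<open>U\<close> and \<open>V\<close> along \<open>e1\<close> cancels their bracket and leaves the brackets with \<open>e1\<close> and
      \<open>g\<close> as they are, as \<open>g\<close> commutes with \<open>e1\<close>.\<close>
    show ?thesis
    proof (rule symplectic_if_noncentral[OF dim ind'])
      show "b e1 (U - q *\<^sub>R e1) = b e1 U" "b e1 (V + p *\<^sub>R e1) = b g U"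
        "b g (U - q *\<^sub>R e1) = b g U" "b e1 g = 0"
        "b g (V + p *\<^sub>R e1) = p' *\<^sub>R b e1 U + q' *\<^sub>R b g U"
        by (simp_all add: expand e1g V pq')
      show "b (U - q *\<^sub>R e1) (V + p *\<^sub>R e1) = 0"
        using antisym[of U e1] by (simp add: expand V pq)
    qed
  qed
qed

section \<open>Algebras with one-dimensional derived algebra\<close>

text \<open>If the image of some \<open>[x,\<cdot>]\<close> contains a nonzero vector of the line \<open>L\<close> of \<open>[e1,e2]\<close>, it is
  contained in \<open>L\<close>; in particular \<open>e1\<close> and \<open>e2\<close> have all their brackets in \<open>L\<close>. A bracket \<open>[u,v]\<close>
  outside \<open>L\<close> thus forces \<open>u\<close> and \<open>v\<close> to commute with \<open>e1\<close> and \<open>e2\<close>, and then \<open>u + e1\<close> has the brackets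
  \<open>[e1,e2]\<close> with \<open>e2\<close> and \<open>[u,v]\<close> with \<open>v\<close>, so its bracket map has rank two.\<close>

lemma brackets_on_line_if_ad_rank_one:
  assumes rank: "\<And>x y z. \<not> lin_indep [b x y, b x z]"
  obtains e1 e2 where "b e1 e2 \<noteq> 0" and "\<And>u v. \<exists>r. b u v = r *\<^sub>R b e1 e2"
proof -
  obtain e1 e2 where nz: "b e1 e2 \<noteq> 0"
    using two_step by (auto simp: two_step_nilpotent_def)
  define L where "L = span {b e1 e2}"
  have L: "r *\<^sub>R v \<in> L" "- v \<in> L" if "v \<in> L" for r v
    using that by (simp_all add: L_def span_scale span_neg)
  have ad: "b x z \<in> L" if "b x y \<noteq> 0" "b x y \<in> L" for x y z
    using dependent_pairE[OF rank that(1)] L(1)[OF that(2)] by metis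
  have e: "b e1 u \<in> L" "b e2 u \<in> L" for u
    using ad[OF nz] ad[of e2 e1] nz L(2)[of "b e1 e2"] antisym[of e2 e1]
    by (auto simp: L_def span_base)
  have sym: "b v u \<in> L" if "b u v \<in> L" for u v
    using L(2)[OF that] antisym[of v u] by simp
  have "b u v \<in> L" for u v
  proof (rule ccontr)
    assume uv: "b u v \<notin> L"
    have "b v u \<notin> L" using uv sym by blast
    then have "b u e2 = 0" "b v e1 = 0"
      using ad[of u e2 v] ad[of v e1 u] uv sym[OF e(2)] sym[OF e(1)] by blast+
    moreover from this have "b e1 v = 0" using antisym[of e1 v] by simp
    ultimately have "b (u + e1) e2 = b e1 e2" "b (u + e1) v = b u v"
      by (simp_all add: expand)
    then show False
      using ad[of "u + e1" e2 v] nz uv by (simp add: L_def span_base)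
  qed
  then have "\<exists>r. b u v = r *\<^sub>R b e1 e2" for u v
    by (auto simp: L_def span_singleton)
  with nz show ?thesis by (rule that)
qed

text \<open>The hypothesis \<open>orth\<close> says that the 2-form \<open>\<phi>\<close> has rank two, that is \<open>\<phi> = \<alpha> \<and> \<beta>\<close> with \<open>\<alpha>\<close>, \<open>\<beta>\<close>
  dual to \<open>e1\<close>, \<open>e2\<close>. Take a basis starting with \<open>e1, f, e2\<close> whose other vectors commute with
  \<open>e1\<close> and \<open>e2\<close>. In the standard symplectic form the partner of \<open>f\<close> is \<open>e1\<close>, so the cyclic sum in
  the closedness condition is \<open>-\<alpha> \<and> \<beta> \<and> \<alpha>\<close>, which vanishes.\<close>

lemma symplectic_if_rank_two:
  assumes dim: "DIM('e) = 2 * k" and f: "b e1 e2 = f" "f \<noteq> 0"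
    and line: "\<And>u v. b u v = \<phi> u v *\<^sub>R f"
    and orth: "\<And>u v. b u e1 = 0 \<Longrightarrow> b u e2 = 0 \<Longrightarrow> b v e1 = 0 \<Longrightarrow> b v e2 = 0 \<Longrightarrow> b u v = 0"
  shows "\<exists>\<omega>. symplectic_form b \<omega>"
proof -
  have e21: "b e2 e1 = - f" using f antisym[of e2 e1] by simp
  have ff: "b f u = 0" for u using f(1) by auto
  define \<alpha> where "\<alpha> u = \<phi> u e2" for u
  define \<beta> where "\<beta> u = \<phi> e1 u" for u
  have \<alpha>: "b u e2 = \<alpha> u *\<^sub>R f" and \<beta>: "b u e1 = - (\<beta> u *\<^sub>R f)" for u
    using line[of u e2] line[of e1 u] antisym[of u e1] by (simp_all add: \<alpha>_def \<beta>_def)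
  \<comment> \<open>The complement of the plane of \<open>e1\<close>, \<open>e2\<close> that is orthogonal to it with respect to \<open>\<phi>\<close>.\<close>
  define W where "W = {w. b w e1 = 0 \<and> b w e2 = 0}"
  have W: "subspace W" by (auto simp: W_def subspace_def expand)
  have split: "u - \<alpha> u *\<^sub>R e1 - \<beta> u *\<^sub>R e2 \<in> W" for u
    using \<alpha>[of u] \<beta>[of u] by (simp add: W_def bilinear_lsub[OF bil] bilinear_lmul[OF bil] f e21)
  have b_eq: "b u v = (\<alpha> u * \<beta> v - \<beta> u * \<alpha> v) *\<^sub>R f" for u v
  proof -
    define u' where "u' = u - \<alpha> u *\<^sub>R e1 - \<beta> u *\<^sub>R e2"
    define v' where "v' = v - \<alpha> v *\<^sub>R e1 - \<beta> v *\<^sub>R e2"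
    have uv: "u = \<alpha> u *\<^sub>R e1 + \<beta> u *\<^sub>R e2 + u'" "v = \<alpha> v *\<^sub>R e1 + \<beta> v *\<^sub>R e2 + v'"
      by (simp_all add: u'_def v'_def)
    have "b u' e1 = 0" "b u' e2 = 0" "b e1 v' = 0" "b e2 v' = 0" "b u' v' = 0"
      using split[of u] split[of v] orth[of u' v'] antisym[of e1 v'] antisym[of e2 v']
      by (simp_all add: W_def u'_def v'_def)
    then show ?thesis
      by (subst uv(1), subst uv(2)) (simp add: expand f e21 algebra_simps)
  qed
  have fW: "{f} \<subseteq> W" by (simp add: W_def ff)
  obtain B where B: "{f} \<subseteq> B" "B \<subseteq> W" "independent B" "W \<subseteq> span B"
    using maximal_independent_subset_extend[OF fW] f(2) by (auto simp: dependent_single)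
  have finB: "finite (B - {f})" using B(3) independent_bound by blast
  obtain ws where ws: "set ws = B - {f}" "distinct ws"
    using finite_distinct_list[OF finB] by blast
  have span_B: "span B = W"
    using B(2,4) W by (simp add: span_minimal subset_antisym)
  have e2: "e2 \<notin> span B"
    using e21 f(2) by (auto simp: span_B W_def)
  have e1: "e1 \<notin> span (insert e2 B)"
  proof
    assume "e1 \<in> span (insert e2 B)"
    then obtain r where "e1 - r *\<^sub>R e2 \<in> W" by (auto simp: span_insert span_B)
    then show False using f by (simp add: W_def expand)
  qed
  have ind: "independent (insert e1 (insert e2 B))"
    using e1 e2 B(3) span_base by (auto simp: independent_insert)
  define vs where "vs = e1 # f # e2 # ws"
  have set: "set vs = insert e1 (insert e2 B)" using B(1) ws(1) by (auto simp: vs_def)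
  have "f \<noteq> e2" "f \<noteq> e1" "e1 \<noteq> e2" "e1 \<notin> B" "e2 \<notin> B"
    using B(1) e1 e2 span_base[of _ "insert e2 B"] span_base[of _ B] by auto
  then have dist: "distinct vs" using ws by (auto simp: vs_def)
  have vs: "lin_indep vs" using ind dist by (simp add: lin_indep_iff set)
  have "u \<in> span (set vs)" for u
  proof -
    have "\<alpha> u *\<^sub>R e1 + \<beta> u *\<^sub>R e2 + (u - \<alpha> u *\<^sub>R e1 - \<beta> u *\<^sub>R e2) \<in> span (set vs)"
      using split[of u] span_mono[of B "set vs"]
      by (intro span_add span_scale) (auto simp: set span_base span_B)
    then show ?thesis by simp
  qed
  then have len: "length vs = DIM('e)"
    using dist ind by (metis (no_types) set distinct_card dim_eq_card dim_UNIV span_UNIV UNIV_eq_I)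
  show ?thesis
  proof (rule coordinates[OF vs len])
    fix c :: "nat \<Rightarrow> 'e \<Rightarrow> real"
    assume c: "\<And>i. linear (c i)" "\<And>u. u = (\<Sum>i<DIM('e). c i u *\<^sub>R vs ! i)"
      "\<forall>i<DIM('e). \<forall>j<DIM('e). c i (vs ! j) = (if i = j then 1 else 0)"
    have dim3: "3 \<le> DIM('e)" using len by (simp add: vs_def)
    have \<alpha>_eq: "\<alpha> u = c 0 u" for u
    proof -
      have vs_e2: "b (vs ! i) e2 = (if i = 0 then f else 0)" if "i < DIM('e)" for i
      proof -
        have "vs ! i \<in> W \<or> i = 0 \<or> i = 2"
          using that len ws(1) B(2) fW nth_mem[of "i - 3" ws]
          by (auto simp: vs_def nth_Cons' numeral_eq_Suc)
        then show ?thesis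
          using f by (auto simp: vs_def W_def nth_Cons')
      qed
      have "linear (\<lambda>x. b x e2)" using bil by (simp add: bilinear_def)
      then have "b u e2 = (\<Sum>i<DIM('e). c i u *\<^sub>R b (vs ! i) e2)"
        using linear_sum[of "\<lambda>x. b x e2" "\<lambda>i. c i u *\<^sub>R vs ! i" "{..<DIM('e)}"] c(2)[of u]
        by (simp add: bilinear_lmul[OF bil])
      moreover have "(\<Sum>i<DIM('e). c i u *\<^sub>R b (vs ! i) e2)
          = (\<Sum>i<DIM('e). if i = 0 then c 0 u *\<^sub>R f else 0)"
        by (rule sum.cong) (use vs_e2 in auto)
      ultimately have "b u e2 = (\<Sum>i<DIM('e). if i = 0 then c 0 u *\<^sub>R f else 0)"
        by simp
      then have "b u e2 = c 0 u *\<^sub>R f" using dim3 by simp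
      then show ?thesis using \<alpha>[of u] f(2) by simp
    qed
    define \<omega> where
      "\<omega> = (\<lambda>u v. \<Sum>i<k. c (2 * i) u * c (2 * i + 1) v - c (2 * i + 1) u * c (2 * i) v)"
    have \<omega>_f: "\<omega> f w = - c 0 w" for w
    proof -
      have "c i f = (if i = 1 then 1 else 0)" if "i < DIM('e)" for i
        using c(3)[rule_format, OF that, of 1] dim3 by (simp add: vs_def)
      then have "\<omega> f w = (\<Sum>i<k. if i = 0 then - c 0 w else 0)"
        unfolding \<omega>_def by (intro sum.cong) (auto simp: dim)
      also have "\<dots> = - c 0 w" using dim3 dim by simp
      finally show ?thesis .
    qed
    have "\<omega> (r *\<^sub>R f) w = r * \<omega> f w" for r w
      by (simp add: \<omega>_def linear_scale[OF c(1)] sum_distrib_left algebra_simps)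
    then have "\<omega> (r *\<^sub>R f) w = - r * c 0 w" for r w
      by (simp add: \<omega>_f)
    then have "closed_form b \<omega>"
      unfolding closed_form_def by (simp add: b_eq \<alpha>_eq) (simp add: algebra_simps)
    then show ?thesis
      using symplectic_form_in_coordinates[OF dim c] unfolding \<omega>_def by blast
  qed
qed

text \<open>The bracket is determined by these equations: \<open>g\<close> is central, and so is \<open>f\<close>, being a bracket.\<close>

definition heisenberg_basis :: "'e \<Rightarrow> 'e \<Rightarrow> 'e \<Rightarrow> 'e \<Rightarrow> 'e \<Rightarrow> 'e \<Rightarrow> bool" where
  "heisenberg_basis e1 e2 e3 e4 f g \<longleftrightarrow> lin_indep [e1, e2, e3, e4, f, g] \<and>
     b e1 e2 = f \<and> b e3 e4 = f \<and> b e1 e3 = 0 \<and> b e1 e4 = 0 \<and> b e2 e3 = 0 \<and> b e2 e4 = 0 \<and>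
     (\<forall>u. b g u = 0)"

text \<open>Orthogonality with respect to \<open>\<phi>\<close> makes \<open>e1, e2, e3, e4, f\<close> independent. Subtracting from a sixth
  vector its \<open>\<phi>\<close>-components along the two hyperbolic pairs leaves a vector \<open>g\<close> that commutes with all
  five, hence is central.\<close>

lemma heisenberg_basis_if_rank_four:
  assumes dim: "even (DIM('e))" "DIM('e) \<le> 6" and f: "f \<noteq> 0"
    and br: "b e1 e2 = f" "b e3 e4 = f" "b e1 e3 = 0" "b e1 e4 = 0" "b e2 e3 = 0" "b e2 e4 = 0"
    and line: "\<And>u v. b u v = \<phi> u v *\<^sub>R f"
  shows "DIM('e) = 6" and "\<exists>g. heisenberg_basis e1 e2 e3 e4 f g"
proof -
  have br': "b e2 e1 = - f" "b e4 e3 = - f" "b e3 e1 = 0" "b e4 e1 = 0" "b e3 e2 = 0" "b e4 e2 = 0"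
    by (subst antisym, simp add: br)+
  have f': "b f u = 0" "b u f = 0" for u by (simp_all flip: br(1))
  note tab = br br' f'
  have ind5: "lin_indep [e1, e2, e3, e4, f]"
  proof (rule lin_indep5I)
    fix a0 a1 a2 a3 a4 :: real
    assume 0: "a0 *\<^sub>R e1 + a1 *\<^sub>R e2 + a2 *\<^sub>R e3 + a3 *\<^sub>R e4 + a4 *\<^sub>R f = 0" (is "?s = 0")
    have "b ?s e1 = 0" "b ?s e2 = 0" "b ?s e3 = 0" "b ?s e4 = 0" unfolding 0 by simp_all
    then have "a0 = 0 \<and> a1 = 0 \<and> a2 = 0 \<and> a3 = 0" using f by (simp add: expand tab)
    then show "a0 = 0 \<and> a1 = 0 \<and> a2 = 0 \<and> a3 = 0 \<and> a4 = 0" using 0 f by simp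
  qed
  have "5 \<le> DIM('e)" using lin_indep_length_le[OF ind5] by simp
  with dim show dim: "DIM('e) = 6" by presburger
  obtain g0 where ind0: "lin_indep ([e1, e2, e3, e4, f] @ [g0])"
    using lin_indep_extend[OF ind5] dim by auto
  define g where "g = g0 + (\<phi> g0 e1 *\<^sub>R e2 - \<phi> g0 e2 *\<^sub>R e1 + \<phi> g0 e3 *\<^sub>R e4 - \<phi> g0 e4 *\<^sub>R e3)"
  have ind: "lin_indep [e1, e2, e3, e4, f, g]"
    unfolding g_def
    by (rule lin_indep_shift[OF ind0, simplified])
      (intro span_add span_diff span_scale span_base; simp)
  have g: "b g e1 = 0" "b g e2 = 0" "b g e3 = 0" "b g e4 = 0"
    unfolding g_def using line[of g0 e1] line[of g0 e2] line[of g0 e3] line[of g0 e4]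
    by (simp_all add: expand tab)
  have "b g u = 0" for u
  proof -
    obtain a0 a1 a2 a3 a4 a5 where
      u: "u = a0 *\<^sub>R e1 + a1 *\<^sub>R e2 + a2 *\<^sub>R e3 + a3 *\<^sub>R e4 + a4 *\<^sub>R f + a5 *\<^sub>R g"
      using combination6[OF dim ind] .
    show ?thesis unfolding u by (simp add: expand tab g)
  qed
  then show "\<exists>g. heisenberg_basis e1 e2 e3 e4 f g"
    using ind br unfolding heisenberg_basis_def by blast
qed

lemma symplectic_or_heisenberg:
  assumes dim: "even (DIM('e))" "DIM('e) \<le> 6"
  shows "(\<exists>\<omega>. symplectic_form b \<omega>) \<or>
    DIM('e) = 6 \<and> (\<exists>e1 e2 e3 e4 f g. heisenberg_basis e1 e2 e3 e4 f g)"
proof (cases "\<exists>x y z. lin_indep [b x y, b x z]")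
  case True
  then show ?thesis using symplectic_if_ad_rank_two[OF dim] by blast
next
  case False
  then obtain e1 e2 where nz: "b e1 e2 \<noteq> 0" and "\<And>u v. \<exists>r. b u v = r *\<^sub>R b e1 e2"
    using brackets_on_line_if_ad_rank_one by blast
  then obtain \<phi> where line: "\<And>u v. b u v = \<phi> u v *\<^sub>R b e1 e2" by metis
  show ?thesis
  proof (cases "\<exists>u v. b u e1 = 0 \<and> b u e2 = 0 \<and> b v e1 = 0 \<and> b v e2 = 0 \<and> b u v \<noteq> 0")
    case True
    then obtain e3 v where e3: "b e3 e1 = 0" "b e3 e2 = 0" "b v e1 = 0" "b v e2 = 0" "b e3 v \<noteq> 0"
      by blast
    define e4 where "e4 = (1 / \<phi> e3 v) *\<^sub>R v"
    have br: "b e1 e2 = b e1 e2" "b e3 e4 = b e1 e2" "b e1 e3 = 0" "b e1 e4 = 0" "b e2 e3 = 0" "b e2 e4 = 0"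
      using e3 line[of e3 v] antisym[of e1 e3] antisym[of e2 e3] antisym[of e1 v] antisym[of e2 v]
      by (simp_all add: e4_def expand)
    show ?thesis
      using heisenberg_basis_if_rank_four[OF dim nz br line] by blast
  next
    case False
    obtain k where k: "DIM('e) = 2 * k" using dim(1) by (rule evenE)
    have "\<exists>\<omega>. symplectic_form b \<omega>"
      using symplectic_if_rank_two[OF k refl nz line] False by blast
    then show ?thesis ..
  qed
qed

end

section \<open>The exceptional algebra\<close>

lemma forall_5: "(\<forall>i::5. P i) \<longleftrightarrow> P 1 \<and> P 2 \<and> P 3 \<and> P 4 \<and> P 5"
proof -
  have "i = 1 \<or> i = 2 \<or> i = 3 \<or> i = 4 \<or> i = 5" for i :: 5
  proof (induct i)
    case (of_int z)
    then have "z = 0 \<or> z = 1 \<or> z = 2 \<or> z = 3 \<or> z = 4" by auto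
    then show ?case by auto
  qed
  then show ?thesis by metis
qed

lemma axis_5 [simp]:
  "axis 1 (1::real) $ (i::5) = (if i = 1 then 1 else 0)"
  "axis 2 (1::real) $ (i::5) = (if i = 2 then 1 else 0)"
  "axis 3 (1::real) $ (i::5) = (if i = 3 then 1 else 0)"
  "axis 4 (1::real) $ (i::5) = (if i = 4 then 1 else 0)"
  "axis 5 (1::real) $ (i::5) = (if i = 5 then 1 else 0)"
  by (auto simp: axis_def)

context two_step_lie_algebra
begin

text \<open>The isomorphism takes coordinates in the given basis: \<open>f\<close> goes to the fifth basis vector of
  \<open>h\<^sub>2(\<real>)\<close> and \<open>g\<close> spans the abelian summand.\<close>

lemma isomorphic_if_heisenberg_basis:
  assumes dim: "DIM('e) = 6" and "heisenberg_basis e1 e2 e3 e4 f g"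
  shows "lie_isomorphic b h2_plus_R_bracket"
proof -
  have ind: "lin_indep [e1, e2, e3, e4, f, g]"
    and br: "b e1 e2 = f" "b e3 e4 = f" "b e1 e3 = 0" "b e1 e4 = 0" "b e2 e3 = 0" "b e2 e4 = 0"
    and g: "\<And>u. b g u = 0" "\<And>u. b u g = 0"
    using assms(2) antisym[of _ g] by (auto simp: heisenberg_basis_def)
  have br': "b e2 e1 = - f" "b e4 e3 = - f" "b e3 e1 = 0" "b e4 e1 = 0" "b e3 e2 = 0" "b e4 e2 = 0"
    by (subst antisym, simp add: br)+
  have f: "b f u = 0" "b u f = 0" for u by (simp_all flip: br(1))
  note tab = br br' f g
  have len: "length [e1, e2, e3, e4, f, g] = DIM('e)" using dim by simp
  show ?thesis
  proof (rule coordinates[OF ind len])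
    fix c :: "nat \<Rightarrow> 'e \<Rightarrow> real"
    assume c: "\<And>i. linear (c i)" "\<And>u. u = (\<Sum>i<DIM('e). c i u *\<^sub>R [e1, e2, e3, e4, f, g] ! i)"
      "\<forall>i<DIM('e). \<forall>j<DIM('e). c i ([e1, e2, e3, e4, f, g] ! j) = (if i = j then 1 else 0)"
    note comb = coordinates6(1)[OF dim c] and coords = coordinates6(2)[OF dim c]
    define F :: "'e \<Rightarrow> (real^5) \<times> real" where
      "F u = ((\<chi> i. if i = 1 then c 0 u else if i = 2 then c 1 u else if i = 3 then c 2 u
        else if i = 4 then c 3 u else c 4 u), c 5 u)" for u
    define H where "H y = fst y $ 1 *\<^sub>R e1 + fst y $ 2 *\<^sub>R e2 + fst y $ 3 *\<^sub>R e3 + fst y $ 4 *\<^sub>R e4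
      + fst y $ 5 *\<^sub>R f + snd y *\<^sub>R g" for y :: "(real^5) \<times> real"
    have F_nth: "fst (F u) $ 1 = c 0 u" "fst (F u) $ 2 = c 1 u" "fst (F u) $ 3 = c 2 u"
      "fst (F u) $ 4 = c 3 u" "fst (F u) $ 5 = c 4 u" "snd (F u) = c 5 u" for u
      by (simp_all add: F_def)
    have eqI: "x = y" if "fst x $ 1 = fst y $ 1" "fst x $ 2 = fst y $ 2" "fst x $ 3 = fst y $ 3"
      "fst x $ 4 = fst y $ 4" "fst x $ 5 = fst y $ 5" "snd x = snd y" for x y :: "(real^5) \<times> real"
      using that by (simp add: prod_eq_iff vec_eq_iff forall_5)
    have "linear F"
      by (rule linearI; rule eqI)
        (simp_all add: F_nth linear_add[OF c(1)] linear_scale[OF c(1)] del: One_nat_def)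
    moreover have "bij F"
    proof (rule o_bij)
      show "H \<circ> F = id"
        using comb by (simp add: fun_eq_iff H_def F_nth del: One_nat_def)
      show "F \<circ> H = id"
        using coords[OF H_def] by (auto simp: F_nth simp del: One_nat_def intro!: eqI ext)
    qed
    moreover have "F (b u v) = h2_plus_R_bracket (F u) (F v)" for u v
    proof -
      have "b u v = 0 *\<^sub>R e1 + 0 *\<^sub>R e2 + 0 *\<^sub>R e3 + 0 *\<^sub>R e4
          + ((c 0 u * c 1 v - c 1 u * c 0 v) + (c 2 u * c 3 v - c 3 u * c 2 v)) *\<^sub>R f + 0 *\<^sub>R g"
        by (subst comb[of u], subst comb[of v]) (simp add: expand tab algebra_simps)
      from coords[OF this] show ?thesis
        by (intro eqI) (simp_all add: F_nth h2_plus_R_bracket_def direct_sum_bracket_def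
            h2_bracket_def del: One_nat_def)
    qed
    ultimately show ?thesis unfolding lie_isomorphic_def by blast
  qed
qed

text \<open>The two pairs of \<open>h\<^sub>2(\<real>)\<close> put the fifth basis vector into the kernel of every closed form. The
  form \<open>\<gamma>\<close> is the wedge product of the abelian coordinate with the first one: both vanish on brackets,
  and the first one also vanishes on the center.\<close>

lemma h2_plus_R_exception:
  assumes "lie_isomorphic b h2_plus_R_bracket"
  shows "\<not> symplectic_form b \<omega>"
    and "\<exists>\<omega>. two_form \<omega> \<and> closed_form b \<omega> \<and> type_II b \<omega>"
proof -
  obtain F where F: "linear F" "bij F" and hom: "\<And>u v. F (b u v) = h2_plus_R_bracket (F u) (F v)"
    using assms by (auto simp: lie_isomorphic_def)
  have inj: "F u = F v \<longleftrightarrow> u = v" for u v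
    using F(2) by (simp add: bij_def inj_eq)
  obtain H where FH: "\<And>y. F (H y) = y"
    using F(2) bij_is_surj surjD by metis
  have F0: "F 0 = 0" using F(1) by (rule linear_0)
  define e where "e i = H (axis i 1, 0)" for i
  have F_e: "F (e i) = (axis i 1, 0)" for i by (simp add: e_def FH)
  have F_b: "F (b u v) = ((fst (F u) $ 1 * fst (F v) $ 2 - fst (F u) $ 2 * fst (F v) $ 1
      + (fst (F u) $ 3 * fst (F v) $ 4 - fst (F u) $ 4 * fst (F v) $ 3)) *\<^sub>R axis 5 1, 0)" for u v
    by (simp add: hom h2_plus_R_bracket_def direct_sum_bracket_def h2_bracket_def)
  have table: "b (e 1) (e 2) = e 5" "b (e 3) (e 4) = e 5" "b (e 1) (e 3) = 0" "b (e 1) (e 4) = 0"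
    "b (e 2) (e 3) = 0" "b (e 2) (e 4) = 0"
    by (simp_all add: F_b F_e F0 zero_prod_def flip: inj)
  have line: "\<exists>r. b u v = r *\<^sub>R e 5" for u v
    by (simp only: inj[symmetric] F_b linear_scale[OF F(1)] F_e scaleR_Pair) auto
  have "axis 5 (1::real) \<noteq> (0 :: real^5)" by (simp add: axis_eq_0_iff)
  then have "e 5 \<noteq> 0" using F_e[of 5] F0 by (auto simp: zero_prod_def)
  then show "\<not> symplectic_form b \<omega>"
    using closed_form_kernel[OF _ _ table line]
    unfolding symplectic_form_def nondegenerate_def by blast
  define \<gamma> where "\<gamma> u v = snd (F u) * fst (F v) $ 1 - fst (F u) $ 1 * snd (F v)" for u v
  have "two_form \<gamma>"
    unfolding two_form_def bilinear_def \<gamma>_def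
    by (auto intro!: linearI simp: linear_add[OF F(1)] linear_scale[OF F(1)] algebra_simps)
  moreover have "closed_form b \<gamma>"
    by (simp add: closed_form_def \<gamma>_def F_b)
  moreover have "type_II b \<gamma>"
  proof -
    have center: "fst (F z) $ 1 = 0" if "z \<in> lie_center b" for z
    proof -
      have "b z (e 2) = 0" using that by (simp add: lie_center_def)
      then have "fst (F (b z (e 2))) $ 5 = 0" by (simp add: F0)
      then show ?thesis by (simp add: F_b F_e)
    qed
    define g where "g = H (0, 1)"
    have "b g u = 0" for u
      by (simp add: F_b F0 g_def FH zero_prod_def flip: inj)
    then have "g \<in> lie_center b" by (simp add: lie_center_def)
    moreover have "\<gamma> g (e 1) \<noteq> 0" by (simp add: \<gamma>_def F_e g_def FH)
    ultimately show ?thesis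
      using center by (auto simp: type_II_def \<gamma>_def)
  qed
  ultimately show "\<exists>\<omega>. two_form \<omega> \<and> closed_form b \<omega> \<and> type_II b \<omega>" by blast
qed

end

section \<open>Symplectic forms and forms of type II in dimension at most six\<close>

theorem theorem4p2:
  fixes G :: "('p, 'm) monoid_scheme"
    and T :: "'p topology"
    and A :: "('p, 'e::euclidean_space) chart set"
    and U :: "'p set" and \<phi> :: "'p \<Rightarrow> 'e"
    and b :: "'e \<Rightarrow> 'e \<Rightarrow> 'e"
    and n :: nat
  assumes "lie_group G T A"
    and "(U, \<phi>) \<in> A" and "\<one>\<^bsub>G\<^esub> \<in> U"
    and "b = lie_bracket G (U, \<phi>)"
    and "two_step_nilpotent b"
    and "DIM('e) = 2 * n" and "n \<le> 3"
  shows "(\<not> lie_isomorphic b h2_plus_R_bracket \<longrightarrow>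
            ((\<exists>\<omega>. symplectic_form b \<omega>) \<longleftrightarrow>
             (\<exists>\<omega>. two_form \<omega> \<and> closed_form b \<omega> \<and> type_II b \<omega>)))
       \<and> (lie_isomorphic b h2_plus_R_bracket \<longrightarrow>
            \<not> ((\<exists>\<omega>. symplectic_form b \<omega>) \<longleftrightarrow>
               (\<exists>\<omega>. two_form \<omega> \<and> closed_form b \<omega> \<and> type_II b \<omega>)))"
proof -
  interpret two_step_lie_algebra b
    using lie_bracket_bilinear[OF assms(1-3)] lie_bracket_self assms(4,5)
    by unfold_locales auto
  have "even (DIM('e))" "DIM('e) \<le> 6"
    using assms(6,7) by simp_all
  from symplectic_or_heisenberg[OF this] show ?thesis
    using closed_type_II_if_symplectic isomorphic_if_heisenberg_basis h2_plus_R_exception by blast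
qed

end
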